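(* Let $\mathcal F:\mathcal L^p\to(-\infty,\infty]$ be a closed proper convex functional, let $\mathcal F^*:\mathcal L^q\to(-\infty,\infty]$ be its conjugate, and let $\mathcal Q=\{Q\in\mathcal L^q\mid\mathcal F^*(Q)<\infty\}$. Then: (i) $\mathcal F$ is a subregular error measure if and only if $\mathcal F^*$ satisfies: (E1* ) $\mathcal F^*(Q)\ge\mathcal F^*(0)=0$ for every $Q\in\mathcal L^q$; (E2* ) for any non-zero $X\in\mathcal L^p$ there exists $Q\in\mathcal Q$ such that $\mathbb E[XQ]>0$. (ii) $\mathcal F$ is a subregular regret measure if and only if $\mathcal F^*$ satisfies: (V1* ) $\mathcal F^*(Q)\ge\mathcal F^*(1)=0$ for every $Q\in\mathcal L^q$; (V2* ) for any non-zero $X\in\mathcal L^p$ there exists $Q\in\mathcal Q$ such that $\mathbb E[XQ]>\mathbb E[X]$. (iii) $\mathcal F$ is a subregular deviation measure if and only if $\mathcal F^*$ satisfies: (D1* ) $\mathcal F^*(Q)\ge\mathcal F^*(0)=0$ for every $Q\in\mathcal L^q$; (D2* ) $\mathbb E[Q]=0$ for every $Q\in\mathcal Q$; (D3* ) for any non-constant $X\in\mathcal L^p$ there exists $Q\in\mathcal Q$ such that $\mathbb E[XQ]>0$. (iv) $\mathcal F$ is a subregular risk measure if and only if $\mathcal F^*$ satisfies: (R1* ) $\mathcal F^*(Q)\ge\mathcal F^*(1)=0$ for every $Q\in\mathcal L^q$; (R2* ) $\mathbb E[Q]=1$ for every $Q\in\mathcal Q$; (R3* ) for any non-constant $X\in\mathcal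 L^p$ there exists $Q\in\mathcal Q$ such that $\mathbb E[XQ]>\mathbb E[X]$.
   Context: Let $(\Omega,\mathcal M,\mathbb P)$ be a probability space, $p\in[1,\infty)$, $\frac1p+\frac1q=1$ (with $q=\infty$ if $p=1$). $\mathcal L^p,\mathcal L^q$ are the usual spaces of random variables (identified when equal almost surely), paired by $\langle X,Q\rangle=\mathbb E[XQ]$; when $q=\infty$, $\mathcal L^\infty$ carries the weak-$*$ topology induced by $\mathcal L^1$. Constants are identified with constant random variables. A functional is closed if all its sublevel sets are closed. The conjugate of $\mathcal F$ is $$\mathcal F^*(Q)=\sup_{X\in\mathcal L^p}\big(\mathbb E[XQ]-\mathcal F(X)\big),\qquad Q\in\mathcal L^q.$$ A subregular risk measure is a closed convex $\mathcal R:\mathcal L^p\to(-\infty,\infty]$ such that $\mathcal R(C)=C$ for constants $C$, $\mathcal R(X)\ge\mathbb E[X]$ for all $X$, and for every non-constant $X$ there is $\lambda>0$ with $\mathcal R(\lambda X)>\mathbb E[\lambda X]$. A subregular deviation measure is a closed convex $\mathcal D:\mathcal L^p\to[0,\infty]$ such that $\mathcal D(C)=0$ for constants $C$, and for every non-constant $X$ there is $\lambda>0$ with $\mathcal D(\lambda X)>0$. A subregular regret measure is a closed convex $\mathcal V:\mathcal L^p\to(-\infty,\infty]$ such that $\mathcal V(0)=0$, $\mathcal V(X)\ge\mathbb E[X]$ for all $X$, and for every non-zero $X$ there is $\lambda>0$ with $\mathcal V(\lambda X)>\mathbb E[\lambda X]$. A subregular error measure is a closed convex $\mathcal E:\mathcal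 L^p\to[0,\infty]$ such that $\mathcal E(0)=0$, and for every non-zero $X$ there is $\lambda>0$ with $\mathcal E(\lambda X)>0$. *)

theory Defs
  imports "HOL-Probability.Probability"
begin

text \<open>
  Random variables are represented by functions rather than by classes of almost surely equal
  functions: functionals are required to respect almost sure equality, and ``constant'' and
  ``zero'' are always meant almost surely. The values of a functional on functions outside
  the L-p space are irrelevant.
\<close>

definition Lspace :: "'a measure \<Rightarrow> ennreal \<Rightarrow> ('a \<Rightarrow> real) set" where
  "Lspace M r = {X \<in> borel_measurable M.
     if r = \<infinity> then \<exists>C. AE x in M. \<bar>X x\<bar> \<le> C
     else integrable M (\<lambda>x. \<bar>X x\<bar> powr enn2real r)}"

definition Lnorm :: "'a measure \<Rightarrow> real \<Rightarrow> ('a \<Rightarrow> real) \<Rightarrow> real" where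
  "Lnorm M p X = (\<integral>x. \<bar>X x\<bar> powr p \<partial>M) powr (1 / p)"

text \<open>
  The topology of the norm (on representatives: of the seminorm), for a finite exponent.
\<close>

definition Ltopology :: "'a measure \<Rightarrow> real \<Rightarrow> ('a \<Rightarrow> real) topology" where
  "Ltopology M p = topology (\<lambda>U. U \<subseteq> Lspace M p \<and>
     (\<forall>X\<in>U. \<exists>e>0. \<forall>Y\<in>Lspace M p. Lnorm M p (\<lambda>x. Y x - X x) < e \<longrightarrow> Y \<in> U))"

lemma openin_Ltopology:
  "openin (Ltopology M p) U \<longleftrightarrow> U \<subseteq> Lspace M p \<and>
     (\<forall>X\<in>U. \<exists>e>0. \<forall>Y\<in>Lspace M p. Lnorm M p (\<lambda>x. Y x - X x) < e \<longrightarrow> Y \<in> U)"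
proof -
  have "istopology (\<lambda>U. U \<subseteq> Lspace M p \<and>
     (\<forall>X\<in>U. \<exists>e>0. \<forall>Y\<in>Lspace M p. Lnorm M p (\<lambda>x. Y x - X x) < e \<longrightarrow> Y \<in> U))"
    (is "istopology ?P")
    unfolding istopology_def
  proof (intro conjI allI impI)
    fix S T assume S: "?P S" and T: "?P T"
    show "S \<inter> T \<subseteq> Lspace M p" using S by blast
    show "\<forall>X\<in>S \<inter> T. \<exists>e>0. \<forall>Y\<in>Lspace M p.
        Lnorm M p (\<lambda>x. Y x - X x) < e \<longrightarrow> Y \<in> S \<inter> T"
    proof
      fix X assume X: "X \<in> S \<inter> T"
      obtain d where d: "d > 0"
          "\<forall>Y\<in>Lspace M p. Lnorm M p (\<lambda>x. Y x - X x) < d \<longrightarrow> Y \<in> S"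
        using S X by blast
      obtain e where e: "e > 0"
          "\<forall>Y\<in>Lspace M p. Lnorm M p (\<lambda>x. Y x - X x) < e \<longrightarrow> Y \<in> T"
        using T X by blast
      show "\<exists>e>0. \<forall>Y\<in>Lspace M p. Lnorm M p (\<lambda>x. Y x - X x) < e \<longrightarrow> Y \<in> S \<inter> T"
        using d e by (intro exI[of _ "min d e"]) auto
    qed
  next
    fix K assume K: "\<forall>S\<in>K. ?P S"
    show "\<Union>K \<subseteq> Lspace M p" using K by blast
    show "\<forall>X\<in>\<Union>K. \<exists>e>0. \<forall>Y\<in>Lspace M p.
        Lnorm M p (\<lambda>x. Y x - X x) < e \<longrightarrow> Y \<in> \<Union>K"
      using K by (meson UnionE UnionI)
  qed
  then show ?thesis
    unfolding Ltopology_def by (simp add: topology_inverse')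
qed

lemma topspace_Ltopology: "topspace (Ltopology M p) = Lspace M p"
proof (rule antisym)
  show "topspace (Ltopology M p) \<subseteq> Lspace M p"
    by (meson openin_Ltopology openin_topspace)
  have "openin (Ltopology M p) (Lspace M p)"
    unfolding openin_Ltopology by (auto intro: exI[of _ 1])
  then show "Lspace M p \<subseteq> topspace (Ltopology M p)"
    by (rule openin_subset)
qed

text \<open>A map into the extended reals without minus infinity, well defined up to almost sure equality.\<close>

definition functional :: "'a measure \<Rightarrow> real \<Rightarrow> (('a \<Rightarrow> real) \<Rightarrow> ereal) \<Rightarrow> bool" where
  "functional M p F \<longleftrightarrow>
     (\<forall>X\<in>Lspace M p. F X \<noteq> -\<infinity>) \<and>
     (\<forall>X\<in>Lspace M p. \<forall>Y\<in>Lspace M p. (AE x in M. X x = Y x) \<longrightarrow> F X = F Y)"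

definition proper_functional :: "'a measure \<Rightarrow> real \<Rightarrow> (('a \<Rightarrow> real) \<Rightarrow> ereal) \<Rightarrow> bool" where
  "proper_functional M p F \<longleftrightarrow>
     (\<forall>X\<in>Lspace M p. F X \<noteq> -\<infinity>) \<and> (\<exists>X\<in>Lspace M p. F X < \<infinity>)"

definition closed_functional :: "'a measure \<Rightarrow> real \<Rightarrow> (('a \<Rightarrow> real) \<Rightarrow> ereal) \<Rightarrow> bool" where
  "closed_functional M p F \<longleftrightarrow>
     (\<forall>c::real. closedin (Ltopology M p) {X \<in> Lspace M p. F X \<le> c})"

definition convex_functional :: "'a measure \<Rightarrow> real \<Rightarrow> (('a \<Rightarrow> real) \<Rightarrow> ereal) \<Rightarrow> bool" where
  "convex_functional M p F \<longleftrightarrow>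
     (\<forall>X\<in>Lspace M p. \<forall>Y\<in>Lspace M p. \<forall>t::real. 0 < t \<and> t < 1 \<longrightarrow>
        F (\<lambda>x. (1 - t) * X x + t * Y x) \<le> ereal (1 - t) * F X + ereal t * F Y)"

definition as_constant :: "'a measure \<Rightarrow> ('a \<Rightarrow> real) \<Rightarrow> bool" where
  "as_constant M X \<longleftrightarrow> (\<exists>c. AE x in M. X x = c)"

definition as_zero :: "'a measure \<Rightarrow> ('a \<Rightarrow> real) \<Rightarrow> bool" where
  "as_zero M X \<longleftrightarrow> (AE x in M. X x = 0)"

definition conjugate ::
    "'a measure \<Rightarrow> real \<Rightarrow> (('a \<Rightarrow> real) \<Rightarrow> ereal) \<Rightarrow> ('a \<Rightarrow> real) \<Rightarrow> ereal" where
  "conjugate M p F Q = (SUP X\<in>Lspace M p. ereal (\<integral>x. X x * Q x \<partial>M) - F X)"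

definition conjugate_domain ::
    "'a measure \<Rightarrow> real \<Rightarrow> ennreal \<Rightarrow> (('a \<Rightarrow> real) \<Rightarrow> ereal) \<Rightarrow> ('a \<Rightarrow> real) set" where
  "conjugate_domain M p q F = {Q \<in> Lspace M q. conjugate M p F Q < \<infinity>}"

definition subregular_risk :: "'a measure \<Rightarrow> real \<Rightarrow> (('a \<Rightarrow> real) \<Rightarrow> ereal) \<Rightarrow> bool" where
  "subregular_risk M p R \<longleftrightarrow>
     functional M p R \<and> closed_functional M p R \<and> convex_functional M p R \<and>
     (\<forall>c::real. R (\<lambda>_. c) = c) \<and>
     (\<forall>X\<in>Lspace M p. R X \<ge> ereal (\<integral>x. X x \<partial>M)) \<and>
     (\<forall>X\<in>Lspace M p. \<not> as_constant M X \<longrightarrow>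
        (\<exists>l>0. R (\<lambda>x. l * X x) > ereal (\<integral>x. l * X x \<partial>M)))"

definition subregular_deviation :: "'a measure \<Rightarrow> real \<Rightarrow> (('a \<Rightarrow> real) \<Rightarrow> ereal) \<Rightarrow> bool" where
  "subregular_deviation M p D \<longleftrightarrow>
     functional M p D \<and> closed_functional M p D \<and> convex_functional M p D \<and>
     (\<forall>X\<in>Lspace M p. D X \<ge> 0) \<and>
     (\<forall>c::real. D (\<lambda>_. c) = 0) \<and>
     (\<forall>X\<in>Lspace M p. \<not> as_constant M X \<longrightarrow> (\<exists>l>0. D (\<lambda>x. l * X x) > 0))"

definition subregular_regret :: "'a measure \<Rightarrow> real \<Rightarrow> (('a \<Rightarrow> real) \<Rightarrow> ereal) \<Rightarrow> bool" where
  "subregular_regret M p V \<longleftrightarrow>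
     functional M p V \<and> closed_functional M p V \<and> convex_functional M p V \<and>
     V (\<lambda>_. 0) = 0 \<and>
     (\<forall>X\<in>Lspace M p. V X \<ge> ereal (\<integral>x. X x \<partial>M)) \<and>
     (\<forall>X\<in>Lspace M p. \<not> as_zero M X \<longrightarrow>
        (\<exists>l>0. V (\<lambda>x. l * X x) > ereal (\<integral>x. l * X x \<partial>M)))"

definition subregular_error :: "'a measure \<Rightarrow> real \<Rightarrow> (('a \<Rightarrow> real) \<Rightarrow> ereal) \<Rightarrow> bool" where
  "subregular_error M p E \<longleftrightarrow>
     functional M p E \<and> closed_functional M p E \<and> convex_functional M p E \<and>
     (\<forall>X\<in>Lspace M p. E X \<ge> 0) \<and>
     E (\<lambda>_. 0) = 0 \<and>
     (\<forall>X\<in>Lspace M p. \<not> as_zero M X \<longrightarrow> (\<exists>l>0. E (\<lambda>x. l * X x) > 0))"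

end

theory Submission
  imports Defs
begin

text \<open>
  Everything follows from the Fenchel--Moreau inequality: whenever \<open>a < F X\<^sub>0\<close>, some \<open>Q\<close> in the
  domain of the conjugate satisfies \<open>F\<^sup>* Q \<le> E[X\<^sub>0 Q] - a\<close>. Lower semicontinuity and convexity give
  \<open>F Y \<ge> a - n \<parallel>Y - X\<^sub>0\<parallel>\<close>, a sandwich version of Hahn--Banach then yields a linear minorant
  bounded by \<open>n\<close> times the norm, and Riesz representation turns it into a \<open>Q\<close>.
  Errors and deviations are the case \<open>c = 0\<close>, regrets and risks the case \<open>c = 1\<close>, of three
  equivalences about the lower bound \<open>F X \<ge> c E[X]\<close>: the bound together with \<open>F 0 = 0\<close> says
  that \<open>F\<^sup>*\<close> has minimum \<open>0\<close> at \<open>c\<close>; strictness somewhere on the ray through \<open>X\<close> says that some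
  \<open>Q\<close> in the domain separates \<open>X\<close>; and equality on constants says that \<open>E[Q] = c\<close> on the domain.
\<close>

section \<open>Linear functionals below sublinear ones\<close>

text \<open>The obstacle is that \<open>F\<close> may be infinite, even at the point
  \<open>X0\<close> where it is approximated from below. A hyperplane separating
  \<open>(X0, a)\<close> from the epigraph could then be vertical, and convexity along rays from
  \<open>X0\<close> says nothing. Therefore a global lower bound is first won around a point
  \<open>X1\<close> of finite value and only then recentred at \<open>X0\<close>. Given such a
  bound, the sandwich theorem yields the functional directly as a graph, so vertical hyperplanes
  never arise. Random variables are representatives and \<open>Lnorm\<close> is only a seminorm, so
  the duality theory is developed for sets of real functions closed under linear operations. Of a
  linear functional only the one-sided bound \<open>f X \<le> n * Lnorm M p X\<close> is recorded;
  applied to \<open>- X\<close> as well, it is two-sided.\<close>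

definition function_space :: "('a \<Rightarrow> real) set \<Rightarrow> bool" where
  "function_space S \<longleftrightarrow> (\<lambda>_. 0) \<in> S \<and>
     (\<forall>X\<in>S. \<forall>Y\<in>S. (\<lambda>x. X x + Y x) \<in> S) \<and> (\<forall>X\<in>S. \<forall>c. (\<lambda>x. c * X x) \<in> S)"

text \<open>Scaling is demanded as an inequality for positive factors: in this form it passes easily
  through infima, and scaling back by \<open>inverse c\<close> recovers equality in
  \<open>sublinear_on_scale\<close>.\<close>

definition sublinear_on :: "('a \<Rightarrow> real) set \<Rightarrow> (('a \<Rightarrow> real) \<Rightarrow> real) \<Rightarrow> bool" where
  "sublinear_on S P \<longleftrightarrow>
     (\<forall>X\<in>S. \<forall>Y\<in>S. P (\<lambda>x. X x + Y x) \<le> P X + P Y) \<and>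
     (\<forall>X\<in>S. \<forall>c>0. P (\<lambda>x. c * X x) \<le> c * P X)"

definition linear_on :: "('a \<Rightarrow> real) set \<Rightarrow> (('a \<Rightarrow> real) \<Rightarrow> real) \<Rightarrow> bool" where
  "linear_on S f \<longleftrightarrow>
     (\<forall>X\<in>S. \<forall>Y\<in>S. f (\<lambda>x. X x + Y x) = f X + f Y) \<and>
     (\<forall>X\<in>S. \<forall>c. f (\<lambda>x. c * X x) = c * f X)"

lemma function_spaceD:
  assumes "function_space S"
  shows function_space_zero: "(\<lambda>_. 0) \<in> S"
    and function_space_add: "\<And>X Y. X \<in> S \<Longrightarrow> Y \<in> S \<Longrightarrow> (\<lambda>x. X x + Y x) \<in> S"
    and function_space_scale: "\<And>X c. X \<in> S \<Longrightarrow> (\<lambda>x. c * X x) \<in> S"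
    and function_space_uminus: "\<And>X. X \<in> S \<Longrightarrow> (\<lambda>x. - X x) \<in> S"
    and function_space_diff: "\<And>X Y. X \<in> S \<Longrightarrow> Y \<in> S \<Longrightarrow> (\<lambda>x. X x - Y x) \<in> S"
proof -
  show z: "(\<lambda>_. 0) \<in> S" and a: "\<And>X Y. X \<in> S \<Longrightarrow> Y \<in> S \<Longrightarrow> (\<lambda>x. X x + Y x) \<in> S"
    and s: "\<And>X c. X \<in> S \<Longrightarrow> (\<lambda>x. c * X x) \<in> S"
    using assms unfolding function_space_def by blast+
  show m: "(\<lambda>x. - X x) \<in> S" if "X \<in> S" for X using s[OF that, of "-1"] by simp
  show "(\<lambda>x. X x - Y x) \<in> S" if "X \<in> S" "Y \<in> S" for X Y
    using a[OF that(1) m[OF that(2)]] by simp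
qed

lemma sublinear_onD:
  assumes "sublinear_on S P"
  shows sublinear_on_add: "\<And>X Y. X \<in> S \<Longrightarrow> Y \<in> S \<Longrightarrow> P (\<lambda>x. X x + Y x) \<le> P X + P Y"
    and sublinear_on_scale_le: "\<And>X c. X \<in> S \<Longrightarrow> c > 0 \<Longrightarrow> P (\<lambda>x. c * X x) \<le> c * P X"
  using assms unfolding sublinear_on_def by auto

lemma linear_onD:
  assumes "linear_on S f"
  shows linear_on_add: "\<And>X Y. X \<in> S \<Longrightarrow> Y \<in> S \<Longrightarrow> f (\<lambda>x. X x + Y x) = f X + f Y"
    and linear_on_scale: "\<And>X c. X \<in> S \<Longrightarrow> f (\<lambda>x. c * X x) = c * f X"
    and linear_on_uminus: "\<And>X. X \<in> S \<Longrightarrow> f (\<lambda>x. - X x) = - f X"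
proof -
  show "\<And>X Y. X \<in> S \<Longrightarrow> Y \<in> S \<Longrightarrow> f (\<lambda>x. X x + Y x) = f X + f Y"
    and s: "\<And>X c. X \<in> S \<Longrightarrow> f (\<lambda>x. c * X x) = c * f X"
    using assms unfolding linear_on_def by auto
  show "f (\<lambda>x. - X x) = - f X" if "X \<in> S" for X using s[OF that, of "-1"] by simp
qed

lemma linear_on_diff:
  assumes "linear_on S f" "function_space S" "X \<in> S" "Y \<in> S"
  shows "f (\<lambda>x. X x - Y x) = f X - f Y"
  using linear_on_add[OF assms(1,3) function_space_uminus[OF assms(2,4)]]
    linear_on_uminus[OF assms(1,4)] by simp

lemma sublinear_on_scale:
  assumes S: "function_space S" and P: "sublinear_on S P" and X: "X \<in> S" and c: "c > 0"
  shows "P (\<lambda>x. c * X x) = c * P X"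
proof (rule antisym)
  show "P (\<lambda>x. c * X x) \<le> c * P X" by (rule sublinear_on_scale_le[OF P X c])
  have "P (\<lambda>x. inverse c * (c * X x)) \<le> inverse c * P (\<lambda>x. c * X x)"
    using c by (intro sublinear_on_scale_le[OF P function_space_scale[OF S X]]) auto
  moreover have "(\<lambda>x. inverse c * (c * X x)) = X" using c by (auto simp: fun_eq_iff)
  ultimately show "c * P X \<le> P (\<lambda>x. c * X x)" using c by (simp add: field_simps)
qed

lemma sublinear_on_zero:
  assumes "function_space S" "sublinear_on S P"
  shows "P (\<lambda>_. 0) = 0"
  using sublinear_on_scale[OF assms function_space_zero[OF assms(1)], of 2] by simp

lemma sublinear_on_uminus:
  assumes "function_space S" "sublinear_on S P" "X \<in> S"
  shows "- P (\<lambda>x. - X x) \<le> P X"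
  using sublinear_on_add[OF assms(2,3) function_space_uminus[OF assms(1,3)]]
    sublinear_on_zero[OF assms(1,2)] by simp

text \<open>Lowering \<open>q\<close> along \<open>Y\<close>, by taking the infimum of
  \<open>q (X + t Y) - t q Y\<close> over \<open>t \<ge> 0\<close>, keeps it sublinear. Minimality
  forbids any decrease, and the value at \<open>t = 1\<close> then gives superadditivity.\<close>

lemma minimal_sublinear_linear:
  assumes S: "function_space S" and q: "sublinear_on S q"
    and min: "\<And>r X. sublinear_on S r \<Longrightarrow> (\<And>X. X \<in> S \<Longrightarrow> r X \<le> q X) \<Longrightarrow> X \<in> S \<Longrightarrow> q X \<le> r X"
  shows "linear_on S q"
proof -
  have super: "q X + q Y \<le> q (\<lambda>x. X x + Y x)" if X: "X \<in> S" and Y: "Y \<in> S" for X Y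
  proof -
    define r where "r X = (INF t\<in>{0..}. q (\<lambda>x. X x + t * Y x) - t * q Y)" for X
    \<comment> \<open>Subadditivity applied to \<open>X + t Y\<close> and \<open>- X\<close> gives a
      bound free of \<open>t\<close>, so the infimum is a genuine real number.\<close>
    have low: "- q (\<lambda>x. - X x) \<le> q (\<lambda>x. X x + t * Y x) - t * q Y" if "X \<in> S" "t \<ge> 0" for X and t :: real
    proof -
      have XS: "(\<lambda>x. X x + t * Y x) \<in> S"
        by (intro function_space_add[OF S that(1)] function_space_scale[OF S Y])
      have "q (\<lambda>x. (X x + t * Y x) + - X x) \<le> q (\<lambda>x. X x + t * Y x) + q (\<lambda>x. - X x)"
        by (intro sublinear_on_add[OF q XS] function_space_uminus[OF S that(1)])
      moreover have "q (\<lambda>x. (X x + t * Y x) + - X x) = t * q Y"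
        using sublinear_on_scale[OF S q Y, of t] sublinear_on_zero[OF S q] that
        by (cases "t = 0") auto
      ultimately show ?thesis by simp
    qed
    have bdd: "bdd_below ((\<lambda>t. q (\<lambda>x. X x + t * Y x) - t * q Y) ` {0..})" if "X \<in> S" for X
      using low[OF that] by (intro bdd_belowI2) auto
    have rle: "r X \<le> q (\<lambda>x. X x + t * Y x) - t * q Y" if "X \<in> S" "t \<ge> 0" for X t
      unfolding r_def using bdd[OF that(1)] that(2) by (intro cINF_lower) auto
    have rge: "c \<le> r X" if "\<And>t. t \<ge> 0 \<Longrightarrow> c \<le> q (\<lambda>x. X x + t * Y x) - t * q Y" for c X
      unfolding r_def using that by (intro cINF_greatest) auto
    have "sublinear_on S r"
      unfolding sublinear_on_def
    proof (intro conjI ballI allI impI)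
      fix A B assume A: "A \<in> S" and B: "B \<in> S"
      have AB: "(\<lambda>x. A x + B x) \<in> S" by (rule function_space_add[OF S A B])
      have *: "r (\<lambda>x. A x + B x) \<le> (q (\<lambda>x. A x + s * Y x) - s * q Y) + (q (\<lambda>x. B x + t * Y x) - t * q Y)"
        if "s \<ge> 0" "t \<ge> 0" for s t
      proof -
        have "r (\<lambda>x. A x + B x) \<le> q (\<lambda>x. (A x + B x) + (s + t) * Y x) - (s + t) * q Y"
          using that by (intro rle AB) auto
        also have "(\<lambda>x. (A x + B x) + (s + t) * Y x) = (\<lambda>x. (A x + s * Y x) + (B x + t * Y x))"
          by (auto simp: algebra_simps)
        also have "q \<dots> \<le> q (\<lambda>x. A x + s * Y x) + q (\<lambda>x. B x + t * Y x)"
          by (intro sublinear_on_add[OF q] function_space_add[OF S] function_space_scale[OF S] A B Y)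
        finally show ?thesis by (simp add: algebra_simps)
      qed
      \<comment> \<open>The parameters \<open>s\<close> and \<open>t\<close> are independent: the
        infimum is taken over \<open>t\<close> with \<open>s\<close> fixed, and afterwards over
        \<open>s\<close>.\<close>
      have "r (\<lambda>x. A x + B x) - r B \<le> r A"
      proof (rule rge)
        fix s :: real assume s: "s \<ge> 0"
        have "r (\<lambda>x. A x + B x) - (q (\<lambda>x. A x + s * Y x) - s * q Y) \<le> r B"
          by (rule rge) (use *[OF s] in \<open>simp add: algebra_simps\<close>)
        then show "r (\<lambda>x. A x + B x) - r B \<le> q (\<lambda>x. A x + s * Y x) - s * q Y" by simp
      qed
      then show "r (\<lambda>x. A x + B x) \<le> r A + r B" by simp
    next
      fix A and c :: real assume A: "A \<in> S" and c: "c > 0"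
      have "r (\<lambda>x. c * A x) / c \<le> r A"
      proof (rule rge)
        fix t :: real assume t: "t \<ge> 0"
        have "r (\<lambda>x. c * A x) \<le> q (\<lambda>x. c * A x + (c * t) * Y x) - (c * t) * q Y"
          using t c by (intro rle function_space_scale[OF S A]) auto
        also have "(\<lambda>x. c * A x + (c * t) * Y x) = (\<lambda>x. c * (A x + t * Y x))"
          by (auto simp: algebra_simps)
        also have "q \<dots> \<le> c * q (\<lambda>x. A x + t * Y x)"
          by (intro sublinear_on_scale_le[OF q] function_space_add[OF S] function_space_scale[OF S] A Y c)
        finally show "r (\<lambda>x. c * A x) / c \<le> q (\<lambda>x. A x + t * Y x) - t * q Y"
          using c by (simp add: field_simps)
      qed
      then show "r (\<lambda>x. c * A x) \<le> c * r A" using c by (simp add: field_simps)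
    qed
    moreover have "r X \<le> q X" if "X \<in> S" for X using rle[OF that, of 0] by simp
    ultimately have "q X \<le> r X" by (rule min) (use X in auto)
    also have "\<dots> \<le> q (\<lambda>x. X x + 1 * Y x) - 1 * q Y" by (intro rle X) auto
    finally show ?thesis by simp
  qed
  have add: "q (\<lambda>x. X x + Y x) = q X + q Y" if "X \<in> S" "Y \<in> S" for X Y
    using super[OF that] sublinear_on_add[OF q that] by simp
  have neg: "q (\<lambda>x. - X x) = - q X" if "X \<in> S" for X
    using add[OF that function_space_uminus[OF S that]] sublinear_on_zero[OF S q] by simp
  have "q (\<lambda>x. c * X x) = c * q X" if X: "X \<in> S" for X c
  proof (cases "c = 0" "c > 0" rule: bool.exhaust[case_product bool.exhaust])
    case False_False
    then have "c < 0" by auto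
    then have "q (\<lambda>x. - c * - X x) = - c * q (\<lambda>x. - X x)"
      by (intro sublinear_on_scale[OF S q] function_space_uminus[OF S X]) auto
    then show ?thesis using neg[OF X] by simp
  qed (use sublinear_on_scale[OF S q X, of c] sublinear_on_zero[OF S q] in auto)
  with add show ?thesis unfolding linear_on_def by auto
qed

text \<open>Infima of sublinear functionals are in general not subadditive. In a chain the smaller
  of any two members lies below both, and its own subadditivity mediates between them.\<close>

lemma chain_Inf_sublinear:
  assumes S: "function_space S" and C: "C \<noteq> {}" "\<And>g. g \<in> C \<Longrightarrow> sublinear_on S g"
    and tot: "\<And>g h. g \<in> C \<Longrightarrow> h \<in> C \<Longrightarrow> (\<forall>X. g X \<le> h X) \<or> (\<forall>X. h X \<le> g X)"
    and bdd: "\<And>X. X \<in> S \<Longrightarrow> bdd_below ((\<lambda>g. g X) ` C)"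
  shows "sublinear_on S (\<lambda>X. INF g\<in>C. g X)"
  unfolding sublinear_on_def
proof (intro conjI ballI allI impI)
  let ?u = "\<lambda>X. INF g\<in>C. g X"
  have le: "?u X \<le> g X" if "X \<in> S" "g \<in> C" for X g
    using bdd[OF that(1)] that(2) by (intro cINF_lower) auto
  {
    fix A B assume A: "A \<in> S" and B: "B \<in> S"
    have AB: "(\<lambda>x. A x + B x) \<in> S" by (rule function_space_add[OF S A B])
    have *: "?u (\<lambda>x. A x + B x) \<le> g A + h B" if g: "g \<in> C" and h: "h \<in> C" for g h
    proof -
      obtain k where k: "k \<in> C" "k A \<le> g A" "k B \<le> h B" using tot[OF g h] g h by blast
      have "?u (\<lambda>x. A x + B x) \<le> k (\<lambda>x. A x + B x)" by (rule le[OF AB k(1)])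
      also have "\<dots> \<le> k A + k B" by (rule sublinear_on_add[OF C(2)[OF k(1)] A B])
      finally show ?thesis using k by simp
    qed
    have "?u (\<lambda>x. A x + B x) - ?u B \<le> ?u A"
    proof (rule cINF_greatest[OF C(1)])
      fix g assume g: "g \<in> C"
      have "?u (\<lambda>x. A x + B x) - g A \<le> ?u B"
        by (rule cINF_greatest[OF C(1)]) (use *[OF g] in \<open>simp add: algebra_simps\<close>)
      then show "?u (\<lambda>x. A x + B x) - ?u B \<le> g A" by simp
    qed
    then show "?u (\<lambda>x. A x + B x) \<le> ?u A + ?u B" by simp
  }
  fix A and c :: real assume A: "A \<in> S" and c: "c > 0"
  have "?u (\<lambda>x. c * A x) / c \<le> ?u A"
  proof (rule cINF_greatest[OF C(1)])
    fix g assume g: "g \<in> C"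
    have "?u (\<lambda>x. c * A x) \<le> g (\<lambda>x. c * A x)" by (rule le[OF function_space_scale[OF S A] g])
    also have "\<dots> \<le> c * g A" by (rule sublinear_on_scale_le[OF C(2)[OF g] A c])
    finally show "?u (\<lambda>x. c * A x) / c \<le> g A" using c by (simp add: field_simps)
  qed
  then show "?u (\<lambda>x. c * A x) \<le> c * ?u A" using c by (simp add: field_simps)
qed

text \<open>Instead of extending a functional step by step from a subspace, Zorn's lemma picks a
  minimal element among the sublinear functionals below \<open>P\<close>; minimality makes it
  linear.\<close>

theorem hahn_banach_sublinear:
  assumes S: "function_space S" and P: "sublinear_on S P"
  obtains f where "linear_on S f" "\<And>X. X \<in> S \<Longrightarrow> f X \<le> P X"
proof -
  \<comment> \<open>Values outside \<open>S\<close> are pinned to 0 so that the pointwise order is antisymmetric.\<close>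
  define A where "A = {g. sublinear_on S g \<and> (\<forall>X\<in>S. g X \<le> P X) \<and> (\<forall>X. X \<notin> S \<longrightarrow> g X = 0)}"
  \<comment> \<open>The pointwise order is reversed because \<open>predicate_Zorn\<close> produces
    maximal elements.\<close>
  define R :: "(('a \<Rightarrow> real) \<Rightarrow> real) \<Rightarrow> _ \<Rightarrow> bool" where "R g h \<longleftrightarrow> (\<forall>X. h X \<le> g X)" for g h
  have restrict: "(\<lambda>X. if X \<in> S then g X else 0) \<in> A"
    if "sublinear_on S g" "\<And>X. X \<in> S \<Longrightarrow> g X \<le> P X" for g
    using that function_space_add[OF S] function_space_scale[OF S]
    unfolding A_def sublinear_on_def by auto
  \<comment> \<open>The bound depends on \<open>P\<close> alone, so it holds along a whole chain and
    keeps its infimum finite.\<close>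
  have low: "- P (\<lambda>x. - X x) \<le> g X" if g: "g \<in> A" and X: "X \<in> S" for g X
  proof -
    have "g (\<lambda>x. - X x) \<le> P (\<lambda>x. - X x)"
      using g function_space_uminus[OF S X] unfolding A_def by blast
    moreover have "- g (\<lambda>x. - X x) \<le> g X"
      using g by (intro sublinear_on_uminus[OF S _ X]) (auto simp: A_def)
    ultimately show ?thesis by linarith
  qed
  have "\<exists>m\<in>A. \<forall>a\<in>A. R m a \<longrightarrow> a = m"
  proof (rule predicate_Zorn)
    show "partial_order_on A (relation_of R A)"
      unfolding partial_order_on_def preorder_on_def relation_of_def refl_on_def trans_def
        antisym_def R_def
      by (auto intro: order_trans) (intro ext antisym; blast)
  next
    fix C assume C: "C \<in> Chains (relation_of R A)"
    then have CA: "C \<subseteq> A" and tot: "\<And>g h. g \<in> C \<Longrightarrow> h \<in> C \<Longrightarrow> R g h \<or> R h g"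
      unfolding Chains_def relation_of_def by auto
    show "\<exists>u\<in>A. \<forall>a\<in>C. R a u"
    proof (cases "C = {}")
      case True
      then show ?thesis using restrict[OF P] by auto
    next
      case False
      let ?u = "\<lambda>X. INF g\<in>C. g X"
      have bdd: "bdd_below ((\<lambda>g. g X) ` C)" if "X \<in> S" for X
        using low[OF _ that] CA by (intro bdd_belowI2) auto
      have le: "?u X \<le> g X" if "X \<in> S" "g \<in> C" for X g
        using bdd[OF that(1)] that(2) by (intro cINF_lower) auto
      have "sublinear_on S ?u"
        by (rule chain_Inf_sublinear[OF S False _ _ bdd])
          (use CA tot in \<open>auto simp: A_def R_def\<close>)
      moreover obtain g0 where "g0 \<in> C" using False by auto
      then have "?u X \<le> P X" if "X \<in> S" for X
        using le[OF that, of g0] that CA unfolding A_def by fastforce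
      ultimately have "(\<lambda>X. if X \<in> S then ?u X else 0) \<in> A" by (rule restrict)
      moreover have "R g (\<lambda>X. if X \<in> S then ?u X else 0)" if "g \<in> C" for g
        using le[OF _ that] that CA unfolding R_def A_def by auto
      ultimately show ?thesis by blast
    qed
  qed
  then obtain m where m: "m \<in> A" and min: "\<And>a. a \<in> A \<Longrightarrow> R m a \<Longrightarrow> a = m" by blast
  have "linear_on S m"
  proof (rule minimal_sublinear_linear[OF S])
    show "sublinear_on S m" using m unfolding A_def by blast
    fix r X assume r: "sublinear_on S r" "\<And>X. X \<in> S \<Longrightarrow> r X \<le> m X" and X: "X \<in> S"
    have "(\<lambda>X. if X \<in> S then r X else 0) \<in> A"
      by (rule restrict[OF r(1)]) (use r(2) m in \<open>force simp: A_def\<close>)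
    then have "(\<lambda>X. if X \<in> S then r X else 0) = m"
      by (rule min) (use r(2) m in \<open>auto simp: R_def A_def\<close>)
    from fun_cong[OF this, of X] show "m X \<le> r X" using X by simp
  qed
  moreover have "m X \<le> P X" if "X \<in> S" for X using m that unfolding A_def by blast
  ultimately show ?thesis by (rule that)
qed

lemma sublinear_on_scale_nonneg:
  assumes "function_space S" "sublinear_on S P" "X \<in> S" "c \<ge> 0"
  shows "P (\<lambda>x. c * X x) = c * P X"
  using sublinear_on_scale[OF assms(1,2,3), of c] sublinear_on_zero[OF assms(1,2)] assms(4)
  by (cases "c = 0") auto

text \<open>
  The cone generated by \<open>k\<close>, inf-convolved with \<open>N\<close>, is sublinear;
  Hahn--Banach applied to it gives a linear functional below both.
\<close>

lemma linear_sandwich: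
  assumes S: "function_space S" and N: "sublinear_on S N" "\<And>X. X \<in> S \<Longrightarrow> N (\<lambda>x. - X x) = N X"
    and D: "D \<subseteq> S" "D \<noteq> {}"
    and conv: "\<And>X Y t. X \<in> D \<Longrightarrow> Y \<in> D \<Longrightarrow> 0 \<le> t \<Longrightarrow> t \<le> 1 \<Longrightarrow>
      (\<lambda>x. (1 - t) * X x + t * Y x) \<in> D \<and>
      k (\<lambda>x. (1 - t) * X x + t * Y x) \<le> (1 - t) * k X + t * (k Y :: real)"
    and low: "\<And>X. X \<in> D \<Longrightarrow> - N X \<le> k X"
  obtains f where "linear_on S f" "\<And>X. X \<in> S \<Longrightarrow> f X \<le> N X" "\<And>X. X \<in> D \<Longrightarrow> f X \<le> k X"
proof -
  \<comment> \<open>\<open>X\<close> is split into a cone part \<open>s Z\<close>, charged with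
    \<open>s k Z\<close>, and a remainder, charged with \<open>N\<close>. The choice
    \<open>s = 0\<close> leaves \<open>N X\<close>; the choice \<open>s = 1\<close>,
    \<open>Z = X\<close> leaves \<open>k X\<close>.\<close>
  define v where "v X = (\<lambda>(s, Z). s * k Z + N (\<lambda>x. X x - s * Z x))" for X
  define I :: "(real \<times> _) set" where "I = {0..} \<times> D"
  define P where "P X = (INF i\<in>I. v X i)" for X
  have ne: "I \<noteq> {}" using D unfolding I_def by auto
  have sub: "(\<lambda>x. X x - s * Z x) \<in> S" if "X \<in> S" "Z \<in> D" for X Z s
    using that D by (intro function_space_diff[OF S] function_space_scale[OF S]) auto
  have bdd: "bdd_below (v X ` I)" if X: "X \<in> S" for X
  proof (rule bdd_belowI2)
    fix i assume "i \<in> I"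
    then obtain s Z where i: "i = (s, Z)" "s \<ge> 0" "Z \<in> D" unfolding I_def by auto
    have ZS: "Z \<in> S" using i D by auto
    \<comment> \<open>Symmetry of \<open>N\<close> turns the triangle inequality into
      \<open>s * N Z \<le> N X + N (X - s Z)\<close>, which compensates a negative
      \<open>s * k Z\<close>.\<close>
    have "N (\<lambda>x. s * Z x) = N (\<lambda>x. X x + - (X x - s * Z x))" by simp
    also have "\<dots> \<le> N X + N (\<lambda>x. - (X x - s * Z x))"
      by (intro sublinear_on_add[OF N(1) X] function_space_uminus[OF S] sub X i)
    also have "N (\<lambda>x. - (X x - s * Z x)) = N (\<lambda>x. X x - s * Z x)"
      by (rule N(2)[OF sub[OF X i(3)]])
    finally have "s * N Z \<le> N X + N (\<lambda>x. X x - s * Z x)"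
      using sublinear_on_scale_nonneg[OF S N(1) ZS i(2)] by simp
    moreover have "- (s * N Z) \<le> s * k Z" using mult_left_mono[OF low[OF i(3)] i(2)] by simp
    ultimately show "- N X \<le> v X i" unfolding v_def i by simp
  qed
  have le: "P X \<le> s * k Z + N (\<lambda>x. X x - s * Z x)" if "X \<in> S" "s \<ge> 0" "Z \<in> D" for X s Z
    using cINF_lower[OF bdd[OF that(1)], of "(s, Z)"] that unfolding P_def v_def I_def by auto
  have ge: "c \<le> P X" if "\<And>s Z. s \<ge> 0 \<Longrightarrow> Z \<in> D \<Longrightarrow> c \<le> s * k Z + N (\<lambda>x. X x - s * Z x)" for c X
    unfolding P_def using that by (intro cINF_greatest ne) (auto simp: v_def I_def)
  have "sublinear_on S P"
    unfolding sublinear_on_def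
  proof (intro conjI ballI allI impI)
    fix A B assume A: "A \<in> S" and B: "B \<in> S"
    have AB: "(\<lambda>x. A x + B x) \<in> S" by (rule function_space_add[OF S A B])
    have *: "P (\<lambda>x. A x + B x) \<le>
        (s * k Y + N (\<lambda>x. A x - s * Y x)) + (t * k Z + N (\<lambda>x. B x - t * Z x))"
      if s: "s \<ge> 0" "t \<ge> 0" and Y: "Y \<in> D" "Z \<in> D" for s t Y Z
    proof -
      \<comment> \<open>The two cone parts have to be merged into one. \<open>W\<close> is the
        convex combination of \<open>Y\<close> and \<open>Z\<close> with weights
        \<open>s / (s + t)\<close> and \<open>t / (s + t)\<close>, and this is where convexity of
        \<open>k\<close> enters. If \<open>s\<close> and \<open>t\<close> both vanish, any point of
        \<open>D\<close> will do.\<close>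
      obtain W where W: "W \<in> D" "(s + t) * k W \<le> s * k Y + t * k Z"
        "\<And>x. (s + t) * W x = s * Y x + t * Z x"
      proof (cases "s + t = 0")
        case True
        then have "s = 0" "t = 0" using s by auto
        then show ?thesis using that[of Y] Y by auto
      next
        case False
        define r where "r = t / (s + t)"
        have r: "0 \<le> r" "r \<le> 1" "(s + t) * r = t" "(s + t) * (1 - r) = s"
          using s False unfolding r_def by (auto simp: field_simps)
        let ?W = "\<lambda>x. (1 - r) * Y x + r * Z x"
        have WD: "?W \<in> D" and le: "k ?W \<le> (1 - r) * k Y + r * k Z" using conv[OF Y r(1,2)] by auto
        have "(s + t) * k ?W \<le> (s + t) * ((1 - r) * k Y + r * k Z)"
          using le s by (intro mult_left_mono) auto
        then have "(s + t) * k ?W \<le> s * k Y + t * k Z"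
          by (metis (no_types, lifting) distrib_left mult.assoc r(3,4))
        moreover note WD
        moreover have "(s + t) * ?W x = s * Y x + t * Z x" for x
          by (metis (no_types, lifting) distrib_left mult.assoc r(3,4))
        ultimately show ?thesis by (intro that[of ?W])
      qed
      have "P (\<lambda>x. A x + B x) \<le> (s + t) * k W + N (\<lambda>x. (A x + B x) - (s + t) * W x)"
        using s by (intro le AB W) auto
      also have "(\<lambda>x. (A x + B x) - (s + t) * W x) = (\<lambda>x. (A x - s * Y x) + (B x - t * Z x))"
        by (simp add: W(3)) (simp add: algebra_simps)
      also have "N \<dots> \<le> N (\<lambda>x. A x - s * Y x) + N (\<lambda>x. B x - t * Z x)"
        by (intro sublinear_on_add[OF N(1)] sub A B Y)
      finally show ?thesis using W(2) by simp
    qed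
    have "P (\<lambda>x. A x + B x) - P B \<le> P A"
    proof (rule ge)
      fix s :: real and Y assume s: "s \<ge> 0" and Y: "Y \<in> D"
      have "P (\<lambda>x. A x + B x) - (s * k Y + N (\<lambda>x. A x - s * Y x)) \<le> P B"
        by (rule ge) (use *[OF s _ Y] in \<open>simp add: algebra_simps\<close>)
      then show "P (\<lambda>x. A x + B x) - P B \<le> s * k Y + N (\<lambda>x. A x - s * Y x)" by simp
    qed
    then show "P (\<lambda>x. A x + B x) \<le> P A + P B" by simp
  next
    fix A and c :: real assume A: "A \<in> S" and c: "c > 0"
    have "P (\<lambda>x. c * A x) / c \<le> P A"
    proof (rule ge)
      fix s :: real and Z assume s: "s \<ge> 0" and Z: "Z \<in> D"
      have "P (\<lambda>x. c * A x) \<le> (c * s) * k Z + N (\<lambda>x. c * A x - (c * s) * Z x)"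
        using s c by (intro le function_space_scale[OF S A] Z) auto
      also have "(\<lambda>x. c * A x - (c * s) * Z x) = (\<lambda>x. c * (A x - s * Z x))"
        by (auto simp: algebra_simps)
      also have "N \<dots> \<le> c * N (\<lambda>x. A x - s * Z x)"
        by (intro sublinear_on_scale_le[OF N(1)] sub A Z c)
      finally show "P (\<lambda>x. c * A x) / c \<le> s * k Z + N (\<lambda>x. A x - s * Z x)"
        using c by (simp add: field_simps)
    qed
    then show "P (\<lambda>x. c * A x) \<le> c * P A" using c by (simp add: field_simps)
  qed
  then obtain f where f: "linear_on S f" "\<And>X. X \<in> S \<Longrightarrow> f X \<le> P X"
    using hahn_banach_sublinear[OF S] by blast
  obtain Z0 where Z0: "Z0 \<in> D" using D by auto
  have "f X \<le> N X" if "X \<in> S" for X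
    using f(2)[OF that] le[OF that _ Z0, of 0] by simp
  moreover have "f X \<le> k X" if "X \<in> D" for X
    using f(2)[of X] le[of X 1 X] that D sublinear_on_zero[OF S N(1)] by auto
  ultimately show ?thesis by (rule that[OF f(1)])
qed

section \<open>The seminorm of an \<open>L\<^sup>p\<close> space\<close>

lemma powr_convex_nonneg:
  fixes a b p t :: real
  assumes p: "1 \<le> p" and "0 \<le> a" "0 \<le> b" "0 \<le> t" "t \<le> 1"
  shows "((1 - t) * a + t * b) powr p \<le> (1 - t) * a powr p + t * b powr p"
proof -
  \<comment> \<open>With one argument zero, the claim reduces to \<open>s powr p \<le> s\<close> on
    the unit interval.\<close>
  have z: "(s * c) powr p \<le> s * c powr p" if "0 \<le> s" "s \<le> 1" "0 \<le> c" for s c :: real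
  proof -
    have "s powr p \<le> s" using powr_mono'[of 1 p s] p that by simp
    then show ?thesis using that by (simp add: powr_mult mult_right_mono)
  qed
  show ?thesis
  proof (cases "a > 0 \<and> b > 0")
    case True
    then show ?thesis
      using convex_onD[OF powr_convex[OF p], of t a b] assms by simp
  next
    case False
    then have "a = 0 \<or> b = 0" using assms by auto
    then show ?thesis using z[of t b] z[of "1 - t" a] assms p by auto
  qed
qed

lemma conjugate_exponents_cases:
  assumes "1 \<le> p" "1 / ennreal p + 1 / q = 1"
  obtains "p = 1" "q = \<infinity>"
    | r where "1 < p" "1 < r" "1 / p + 1 / r = 1" "q = ennreal r"
proof -
  have p: "1 / ennreal p = ennreal (1 / p)" using assms(1) by (simp add: divide_ennreal flip: ennreal_1)
  show ?thesis
  proof (cases q)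
    case top
    then have "p = 1" using assms p by (auto simp: ennreal_eq_1)
    then show ?thesis using that top by auto
  next
    case (real r)
    have r: "r > 0"
    proof (rule ccontr)
      assume "\<not> r > 0"
      then have "q = 0" using real by auto
      then show False using assms(2) by (simp add: ennreal_divide_zero)
    qed
    then have "ennreal (1 / p + 1 / r) = 1"
      using assms p real by (simp add: divide_ennreal flip: ennreal_1 ennreal_plus)
    then have e: "1 / p + 1 / r = 1" by (simp only: ennreal_eq_1)
    moreover have "1 / p > 0" "1 / r > 0" using assms r by auto
    ultimately have "1 / p < 1" "1 / r < 1" by linarith+
    then have "1 < p" "1 < r" using assms r by simp_all
    then show ?thesis using that e real by auto
  qed
qed

section \<open>The linear structure of \<open>Lspace\<close>\<close>

lemma Lspace_iff:
  assumes "1 \<le> p"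
  shows "X \<in> Lspace M (ennreal p) \<longleftrightarrow>
    X \<in> borel_measurable M \<and> integrable M (\<lambda>x. \<bar>X x\<bar> powr p)"
  using assms unfolding Lspace_def by auto

lemma Lspace_measurable: "X \<in> Lspace M r \<Longrightarrow> X \<in> borel_measurable M"
  unfolding Lspace_def by auto

lemma Lspace_dominated:
  assumes "1 \<le> p" "W \<in> Lspace M (ennreal p)" "X \<in> borel_measurable M"
    and "\<And>x. x \<in> space M \<Longrightarrow> \<bar>X x\<bar> \<le> \<bar>W x\<bar>"
  shows "X \<in> Lspace M (ennreal p)"
proof -
  have W: "integrable M (\<lambda>x. \<bar>W x\<bar> powr p)" using assms Lspace_iff by blast
  have "integrable M (\<lambda>x. \<bar>X x\<bar> powr p)"
    by (rule Bochner_Integration.integrable_bound[OF W])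
      (use assms in \<open>auto intro!: AE_I2 powr_mono2\<close>)
  then show ?thesis using assms Lspace_iff by blast
qed

lemma Lspace_scale:
  assumes "1 \<le> p" "X \<in> Lspace M (ennreal p)"
  shows "(\<lambda>x. c * X x) \<in> Lspace M (ennreal p)"
  using assms by (auto simp: Lspace_iff abs_mult powr_mult)

text \<open>\<open>X + Y\<close> is the midpoint of \<open>2 * X\<close> and \<open>2 * Y\<close>,
  so convexity of the power bounds it.\<close>

lemma Lspace_add:
  assumes p: "1 \<le> p" and X: "X \<in> Lspace M (ennreal p)" and Y: "Y \<in> Lspace M (ennreal p)"
  shows "(\<lambda>x. X x + Y x) \<in> Lspace M (ennreal p)"
proof -
  have i: "integrable M (\<lambda>x. \<bar>2 * X x\<bar> powr p + \<bar>2 * Y x\<bar> powr p)"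
    using Lspace_scale[OF p X, of 2] Lspace_scale[OF p Y, of 2] p
    by (intro Bochner_Integration.integrable_add) (auto simp: Lspace_iff)
  have [measurable]: "X \<in> borel_measurable M" "Y \<in> borel_measurable M"
    using X Y Lspace_measurable by blast+
  have "\<bar>X x + Y x\<bar> powr p \<le> \<bar>2 * X x\<bar> powr p + \<bar>2 * Y x\<bar> powr p" for x
  proof -
    have "\<bar>X x + Y x\<bar> powr p \<le> ((1 - 1/2) * \<bar>2 * X x\<bar> + 1/2 * \<bar>2 * Y x\<bar>) powr p"
      using p by (intro powr_mono2) auto
    also have "\<dots> \<le> (1 - 1/2) * \<bar>2 * X x\<bar> powr p + 1/2 * \<bar>2 * Y x\<bar> powr p"
      by (rule powr_convex_nonneg[OF p]) auto
    also have "\<dots> \<le> \<bar>2 * X x\<bar> powr p + \<bar>2 * Y x\<bar> powr p"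
      by (auto intro!: add_mono)
    finally show ?thesis .
  qed
  then have "integrable M (\<lambda>x. \<bar>X x + Y x\<bar> powr p)"
    by (intro Bochner_Integration.integrable_bound[OF i]) auto
  then show ?thesis using p by (simp add: Lspace_iff)
qed

lemma function_space_Lspace: "1 \<le> p \<Longrightarrow> function_space (Lspace M (ennreal p))"
  unfolding function_space_def by (simp add: Lspace_add Lspace_scale) (simp add: Lspace_iff)

section \<open>Minkowski's inequality, convergence in the seminorm, and integrability of
  products\<close>

lemma Lnorm_nonneg: "0 \<le> Lnorm M p X"
  unfolding Lnorm_def by simp

lemma Lnorm_uminus: "Lnorm M p (\<lambda>x. - X x) = Lnorm M p X"
  unfolding Lnorm_def by simp

lemma Lnorm_scale: "1 \<le> p \<Longrightarrow> Lnorm M p (\<lambda>x. c * X x) = \<bar>c\<bar> * Lnorm M p X"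
  unfolding Lnorm_def by (simp add: abs_mult powr_mult powr_powr)

lemma Lnorm_powr:
  assumes "1 \<le> p" shows "Lnorm M p X powr p = (\<integral>x. \<bar>X x\<bar> powr p \<partial>M)"
  using assms unfolding Lnorm_def by (simp add: powr_powr)

lemma Lnorm_le:
  assumes "1 \<le> p" "0 \<le> c" "(\<integral>x. \<bar>X x\<bar> powr p \<partial>M) \<le> c powr p"
  shows "Lnorm M p X \<le> c"
  using powr_mono2[OF _ _ assms(3), of "1 / p"] assms unfolding Lnorm_def
  by (simp add: powr_powr)

text \<open>With \<open>a\<close> and \<open>b\<close> above the two seminorms,
  \<open>(|X| + |Y|) / (a + b)\<close> is a convex combination of \<open>|X| / a\<close> and
  \<open>|Y| / b\<close>, so by convexity its \<open>p\<close>-th power has integral at most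
  1.\<close>

lemma Lnorm_triangle:
  assumes p: "1 \<le> p" and X: "X \<in> Lspace M (ennreal p)" and Y: "Y \<in> Lspace M (ennreal p)"
  shows "Lnorm M p (\<lambda>x. X x + Y x) \<le> Lnorm M p X + Lnorm M p Y"
proof (rule field_le_epsilon)
  fix e :: real assume e: "e > 0"
  \<comment> \<open>The margin \<open>e / 2\<close> makes \<open>a\<close> and \<open>b\<close>
    positive even when a seminorm vanishes.\<close>
  define a where "a = Lnorm M p X + e / 2"
  define b where "b = Lnorm M p Y + e / 2"
  have pos: "a > 0" "b > 0" using e Lnorm_nonneg[of M p] unfolding a_def b_def by (simp_all add: add_nonneg_pos)
  define t where "t = b / (a + b)"
  have t: "0 \<le> t" "t \<le> 1" "1 - t = a / (a + b)" using pos unfolding t_def by (auto simp: field_simps)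
  have iX: "integrable M (\<lambda>x. \<bar>X x\<bar> powr p)" and iY: "integrable M (\<lambda>x. \<bar>Y x\<bar> powr p)"
    using X Y p by (auto simp: Lspace_iff)
  have iXY: "integrable M (\<lambda>x. \<bar>X x + Y x\<bar> powr p)"
    using Lspace_add[OF p X Y] p by (simp add: Lspace_iff)
  have pw: "\<bar>X x + Y x\<bar> powr p / (a + b) powr p \<le>
      (1 - t) / a powr p * \<bar>X x\<bar> powr p + t / b powr p * \<bar>Y x\<bar> powr p" for x
  proof -
    have "(1 - t) * (\<bar>X x\<bar> / a) = \<bar>X x\<bar> / (a + b)" "t * (\<bar>Y x\<bar> / b) = \<bar>Y x\<bar> / (a + b)"
      unfolding t(3) unfolding t_def using pos by simp_all
    then have "\<bar>X x + Y x\<bar> / (a + b) \<le> (1 - t) * (\<bar>X x\<bar> / a) + t * (\<bar>Y x\<bar> / b)"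
      using pos by (simp add: abs_triangle_ineq divide_right_mono flip: add_divide_distrib)
    then have "(\<bar>X x + Y x\<bar> / (a + b)) powr p \<le> ((1 - t) * (\<bar>X x\<bar> / a) + t * (\<bar>Y x\<bar> / b)) powr p"
      using p pos by (intro powr_mono2) auto
    also have "\<dots> \<le> (1 - t) * (\<bar>X x\<bar> / a) powr p + t * (\<bar>Y x\<bar> / b) powr p"
      using pos t by (intro powr_convex_nonneg[OF p]) auto
    finally show ?thesis using pos by (simp add: powr_divide)
  qed
  have "(\<integral>x. \<bar>X x + Y x\<bar> powr p \<partial>M) / (a + b) powr p
      = (\<integral>x. \<bar>X x + Y x\<bar> powr p / (a + b) powr p \<partial>M)" by simp
  also have "\<dots> \<le> (\<integral>x. (1 - t) / a powr p * \<bar>X x\<bar> powr p + t / b powr p * \<bar>Y x\<bar> powr p \<partial>M)"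
    using iX iY iXY pw by (intro integral_mono) auto
  also have "\<dots> = (1 - t) / a powr p * Lnorm M p X powr p + t / b powr p * Lnorm M p Y powr p"
    using iX iY p by (simp add: Lnorm_powr)
  also have "\<dots> \<le> (1 - t) / a powr p * a powr p + t / b powr p * b powr p"
    using e p t Lnorm_nonneg[of M p]
    by (intro add_mono mult_left_mono powr_mono2) (auto simp: a_def b_def)
  also have "\<dots> = 1" using pos by simp
  finally have "(\<integral>x. \<bar>X x + Y x\<bar> powr p \<partial>M) \<le> (a + b) powr p"
    using pos by (simp add: divide_le_eq)
  then have "Lnorm M p (\<lambda>x. X x + Y x) \<le> a + b" using pos by (intro Lnorm_le[OF p]) auto
  then show "Lnorm M p (\<lambda>x. X x + Y x) \<le> Lnorm M p X + Lnorm M p Y + e"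
    unfolding a_def b_def by simp
qed

lemma sublinear_on_Lnorm:
  assumes "1 \<le> p" "0 \<le> n"
  shows "sublinear_on (Lspace M (ennreal p)) (\<lambda>X. n * Lnorm M p X)"
  unfolding sublinear_on_def
proof (intro conjI ballI allI impI)
  fix X Y assume "X \<in> Lspace M (ennreal p)" "Y \<in> Lspace M (ennreal p)"
  then show "n * Lnorm M p (\<lambda>x. X x + Y x) \<le> n * Lnorm M p X + n * Lnorm M p Y"
    using mult_left_mono[OF Lnorm_triangle assms(2)] assms(1) by (metis distrib_left)
qed (use assms in \<open>simp add: Lnorm_scale\<close>)

text \<open>The limit inherits the bound by \<open>W\<close>, so \<open>2 * W\<close> dominates all
  the differences.\<close>

lemma Lnorm_dominated_convergence:
  assumes p: "1 \<le> p" and W: "W \<in> Lspace M (ennreal p)"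
    and [measurable]: "\<And>i. U i \<in> borel_measurable M" "u \<in> borel_measurable M"
    and dom: "\<And>i x. x \<in> space M \<Longrightarrow> \<bar>U i x\<bar> \<le> \<bar>W x\<bar>"
    and lim: "\<And>x. x \<in> space M \<Longrightarrow> (\<lambda>i. U i x) \<longlonglongrightarrow> u x"
  shows "(\<lambda>i. Lnorm M p (\<lambda>x. U i x - u x)) \<longlonglongrightarrow> 0"
proof -
  have u: "\<bar>u x\<bar> \<le> \<bar>W x\<bar>" if "x \<in> space M" for x
    by (rule LIMSEQ_le_const2[OF tendsto_rabs[OF lim[OF that]]]) (use dom[OF that] in auto)
  have "(\<lambda>i. \<integral>x. \<bar>U i x - u x\<bar> powr p \<partial>M) \<longlonglongrightarrow> (\<integral>x. 0 \<partial>M)"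
  proof (rule integral_dominated_convergence)
    show "integrable M (\<lambda>x. \<bar>2 * W x\<bar> powr p)"
      using Lspace_scale[OF p W, of 2] p by (simp add: Lspace_iff)
    show "AE x in M. (\<lambda>i. \<bar>U i x - u x\<bar> powr p) \<longlonglongrightarrow> 0"
    proof (rule AE_I2)
      fix x assume "x \<in> space M"
      then have "(\<lambda>i. \<bar>U i x - u x\<bar>) \<longlonglongrightarrow> 0"
        using lim by (simp add: LIM_zero tendsto_rabs_zero)
      then have "(\<lambda>i. \<bar>U i x - u x\<bar> powr p) \<longlonglongrightarrow> 0 powr p"
        using p by (intro tendsto_powr2) auto
      then show "(\<lambda>i. \<bar>U i x - u x\<bar> powr p) \<longlonglongrightarrow> 0" by simp
    qed
    show "AE x in M. norm (\<bar>U i x - u x\<bar> powr p) \<le> \<bar>2 * W x\<bar> powr p" for i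
    proof (rule AE_I2)
      fix x assume "x \<in> space M"
      then have "\<bar>U i x - u x\<bar> \<le> \<bar>2 * W x\<bar>" using dom[of x i] u[of x] by auto
      then show "norm (\<bar>U i x - u x\<bar> powr p) \<le> \<bar>2 * W x\<bar> powr p"
        using p by (auto intro!: powr_mono2)
    qed
  qed auto
  then have "(\<lambda>i. (\<integral>x. \<bar>U i x - u x\<bar> powr p \<partial>M) powr (1 / p)) \<longlonglongrightarrow> 0 powr (1 / p)"
    using p by (intro tendsto_powr2) auto
  then show ?thesis unfolding Lnorm_def by simp
qed

text \<open>For \<open>1 < p\<close> Young's inequality dominates the product; for
  \<open>p = 1\<close>, \<open>Q\<close> is essentially bounded. Without integrability the pairing
  would be 0 by the convention for the integral.\<close>

lemma Holder_integrable:
  assumes pq: "1 \<le> p" "1 / ennreal p + 1 / q = 1"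
    and X: "X \<in> Lspace M (ennreal p)" and Q: "Q \<in> Lspace M q"
  shows "integrable M (\<lambda>x. X x * Q x)"
proof -
  have [measurable]: "X \<in> borel_measurable M" "Q \<in> borel_measurable M"
    using X Q Lspace_measurable by blast+
  show ?thesis
  proof (rule conjugate_exponents_cases[OF pq])
    assume "p = 1" "q = \<infinity>"
    then obtain C where C: "AE x in M. \<bar>Q x\<bar> \<le> C" and i: "integrable M (\<lambda>x. \<bar>X x\<bar>)"
      using X Q by (auto simp: Lspace_def)
    have le: "AE x in M. norm (X x * Q x) \<le> norm (C * \<bar>X x\<bar>)"
      using C
    proof eventually_elim
      case (elim x)
      then have "\<bar>X x\<bar> * \<bar>Q x\<bar> \<le> \<bar>X x\<bar> * \<bar>C\<bar>" by (intro mult_left_mono) auto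
      then show ?case by (simp add: abs_mult mult.commute)
    qed
    show ?thesis
      by (rule Bochner_Integration.integrable_bound[OF integrable_mult_right[OF i] _ le]) measurable
  next
    fix r assume r: "1 < p" "1 < r" "1 / p + 1 / r = 1" "q = ennreal r"
    have int: "integrable M (\<lambda>x. \<bar>X x\<bar> powr p / p + \<bar>Q x\<bar> powr r / r)"
    proof (intro Bochner_Integration.integrable_add integrable_divide)
      show "integrable M (\<lambda>x. \<bar>X x\<bar> powr p)" using X r(1) by (simp add: Lspace_iff)
      show "integrable M (\<lambda>x. \<bar>Q x\<bar> powr r)" using Q r(2,4) by (simp add: Lspace_iff)
    qed
    have le: "norm (X x * Q x) \<le> norm (\<bar>X x\<bar> powr p / p + \<bar>Q x\<bar> powr r / r)" for x
    proof -
      have "norm (X x * Q x) = \<bar>X x\<bar> * \<bar>Q x\<bar>" by (simp add: abs_mult)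
      also have "\<dots> \<le> \<bar>X x\<bar> powr p / p + \<bar>Q x\<bar> powr r / r"
        by (rule Youngs_inequality[OF r(1-3)]) simp_all
      also have "\<dots> \<le> norm \<dots>" unfolding real_norm_def by (rule abs_ge_self)
      finally show ?thesis .
    qed
    show ?thesis
      by (rule Bochner_Integration.integrable_bound[OF int _ AE_I2[OF le]]) measurable
  qed
qed

section \<open>The dual of an \<open>L\<^sup>p\<close> space\<close>

context prob_space
begin

lemma Lspace_bounded:
  assumes "1 \<le> p" "X \<in> borel_measurable M" "\<And>x. x \<in> space M \<Longrightarrow> \<bar>X x\<bar> \<le> C"
  shows "X \<in> Lspace M (ennreal p)"
proof (rule Lspace_dominated[of p "\<lambda>_. C"])
  show "(\<lambda>_. C) \<in> Lspace M (ennreal p)" using assms(1) by (simp add: Lspace_iff)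
  show "\<bar>X x\<bar> \<le> \<bar>C\<bar>" if "x \<in> space M" for x using assms(3)[OF that] by linarith
qed (use assms in auto)

lemma Lspace_const: "1 \<le> p \<Longrightarrow> (\<lambda>_. c) \<in> Lspace M (ennreal p)"
  by (rule Lspace_bounded[where C = "\<bar>c\<bar>"]) auto

section \<open>Densities of additive set functions bounded by a power of the probability\<close>

lemma Lnorm_indicator:
  assumes "1 \<le> p" "A \<in> sets M"
  shows "Lnorm M p (indicator A) = prob A powr (1 / p)"
proof -
  have "(\<lambda>x. \<bar>indicator A x :: real\<bar> powr p) = indicator A"
    by (auto simp: indicator_def)
  then show ?thesis using assms unfolding Lnorm_def by simp
qed

text \<open>The bound does double duty: it gives continuity from above at the empty set, hence
  countable additivity, and it gives absolute continuity, hence a Radon-Nikodym density.\<close>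

lemma nonneg_additive_density:
  fixes V :: "'a set \<Rightarrow> real"
  assumes p: "1 \<le> p" and n: "0 \<le> n"
    and nonneg: "\<And>A. A \<in> sets M \<Longrightarrow> 0 \<le> V A"
    and add: "\<And>A B. A \<in> sets M \<Longrightarrow> B \<in> sets M \<Longrightarrow> A \<inter> B = {} \<Longrightarrow> V (A \<union> B) = V A + V B"
    and bound: "\<And>A. A \<in> sets M \<Longrightarrow> V A \<le> n * prob A powr (1 / p)"
  obtains Q where "integrable M Q" "\<And>A. A \<in> sets M \<Longrightarrow> V A = (\<integral>x. indicator A x * Q x \<partial>M)"
proof -
  have V0: "V {} = 0" using add[of "{}" "{}"] by simp
  define N where "N = measure_of (space M) (sets M) (\<lambda>A. ennreal (V A))"
  have setsN[simp, measurable_cong]: "sets N = sets M" unfolding N_def by simp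
  have pos: "positive (sets M) (\<lambda>A. ennreal (V A))" using V0 by (simp add: positive_def)
  have ca: "countably_additive (sets M) (\<lambda>A. ennreal (V A))"
  proof (rule sets.empty_continuous_imp_countably_additive[OF pos])
    show "additive (sets M) (\<lambda>A. ennreal (V A))"
      unfolding additive_def using add nonneg by (auto simp: ennreal_plus)
    show "\<forall>A\<in>sets M. ennreal (V A) \<noteq> \<infinity>" by simp
    fix A :: "nat \<Rightarrow> 'a set"
    assume A: "range A \<subseteq> sets M" "decseq A" "(\<Inter>i. A i) = {}"
    have "(\<lambda>i. prob (A i)) \<longlonglongrightarrow> prob (\<Inter>i. A i)" by (rule finite_Lim_measure_decseq[OF A(1,2)])
    then have "(\<lambda>i. prob (A i)) \<longlonglongrightarrow> 0" using A(3) by simp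
    then have "(\<lambda>i. n * prob (A i) powr (1 / p)) \<longlonglongrightarrow> n * 0 powr (1 / p)"
      using p by (intro tendsto_mult_left tendsto_powr2) auto
    then have lim: "(\<lambda>i. n * prob (A i) powr (1 / p)) \<longlonglongrightarrow> 0" by simp
    have "A i \<in> sets M" for i using A(1) by auto
    then have "(\<lambda>i. V (A i)) \<longlonglongrightarrow> 0"
      by (intro tendsto_sandwich[OF always_eventually always_eventually tendsto_const lim] allI nonneg bound)
    then show "(\<lambda>i. ennreal (V (A i))) \<longlonglongrightarrow> 0"
      using tendsto_ennrealI[of "\<lambda>i. V (A i)" 0 sequentially] by simp
  qed
  have em: "emeasure N A = ennreal (V A)" if "A \<in> sets M" for A
    unfolding N_def using that pos ca
    by (intro emeasure_measure_of_sigma) (auto simp: sets.sigma_algebra_axioms)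
  have spN: "space N = space M" by (rule sets_eq_imp_space_eq) simp
  have fin: "finite_measure N"
    by (rule finite_measureI) (simp add: spN em)
  have ac: "absolutely_continuous M N"
    unfolding absolutely_continuous_def
  proof
    fix A assume A: "A \<in> null_sets M"
    then have "A \<in> sets M" "prob A = 0" by (auto simp: measure_def)
    then have "V A = 0" using bound[of A] nonneg[of A] by simp
    then show "A \<in> null_sets N" using \<open>A \<in> sets M\<close> by (auto simp: em)
  qed
  obtain D where D: "D \<in> borel_measurable M" "AE x in M. RN_deriv M N x = ennreal (D x)" "\<And>x. 0 \<le> D x"
    using real_RN_deriv[OF fin ac setsN] by blast
  note D(1)[measurable]
  have nn: "ennreal (V A) = (\<integral>\<^sup>+x. ennreal (indicator A x * D x) \<partial>M)" if A: "A \<in> sets M" for A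
  proof -
    have "ennreal (V A) = emeasure (density M (RN_deriv M N)) A"
      using em[OF A] density_RN_deriv[OF ac setsN] by simp
    also have "\<dots> = (\<integral>\<^sup>+x. RN_deriv M N x * indicator A x \<partial>M)"
      using A by (intro emeasure_density) auto
    also have "\<dots> = (\<integral>\<^sup>+x. ennreal (indicator A x * D x) \<partial>M)"
      using D(2) by (intro nn_integral_cong_AE) (auto simp: indicator_def)
    finally show ?thesis .
  qed
  have "(\<integral>\<^sup>+x. ennreal (D x) \<partial>M) = (\<integral>\<^sup>+x. ennreal (indicator (space M) x * D x) \<partial>M)"
    by (intro nn_integral_cong) auto
  also have "\<dots> = ennreal (V (space M))" using nn[of "space M"] by simp
  finally have "integrable M D"
    using D by (intro integrableI_nonneg) auto
  moreover have "V A = (\<integral>x. indicator A x * D x \<partial>M)" if A: "A \<in> sets M" for A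
  proof -
    have "(\<integral>x. indicator A x * D x \<partial>M) = enn2real (\<integral>\<^sup>+x. ennreal (indicator A x * D x) \<partial>M)"
      using A D by (intro integral_eq_nn_integral) auto
    then show ?thesis using nn[OF A] nonneg[OF A] by (metis enn2real_ennreal)
  qed
  ultimately show ?thesis by (rule that)
qed

text \<open>The positive and negative parts of the Jordan decomposition of \<open>g\<close> each have a density.\<close>

lemma additive_density:
  fixes g :: "'a set \<Rightarrow> real"
  assumes p: "1 \<le> p" and n: "0 \<le> n"
    and add: "\<And>A B. A \<in> sets M \<Longrightarrow> B \<in> sets M \<Longrightarrow> A \<inter> B = {} \<Longrightarrow> g (A \<union> B) = g A + g B"
    and bound: "\<And>A. A \<in> sets M \<Longrightarrow> \<bar>g A\<bar> \<le> n * prob A powr (1 / p)"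
  obtains Q where "integrable M Q" "\<And>A. A \<in> sets M \<Longrightarrow> g A = (\<integral>x. indicator A x * Q x \<partial>M)"
proof -
  \<comment> \<open>The upper variation of \<open>g\<close>. It inherits the bound on
    \<open>g\<close> because \<open>prob\<close> is monotone, and \<open>V - g\<close> is again
    nonnegative and additive.\<close>
  define V where "V A = (SUP B\<in>{B\<in>sets M. B \<subseteq> A}. g B)" for A
  have g0: "g {} = 0" using add[of "{}" "{}"] by simp
  have mono: "n * prob B powr (1 / p) \<le> n * prob A powr (1 / p)"
    if "A \<in> sets M" "B \<subseteq> A" for A B
    using p n finite_measure_mono[OF that(2,1)] by (intro mult_left_mono powr_mono2) auto
  have gV': "g B \<le> n * prob A powr (1 / p)" if "A \<in> sets M" "B \<in> sets M" "B \<subseteq> A" for A B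
    using bound[OF that(2)] mono[OF that(1,3)] by linarith
  have gV: "g B \<le> V A" if "A \<in> sets M" "B \<in> sets M" "B \<subseteq> A" for A B
    unfolding V_def using that gV'[OF that(1)] by (intro cSUP_upper bdd_aboveI2) auto
  have VI: "V A \<le> c" if "\<And>B. B \<in> sets M \<Longrightarrow> B \<subseteq> A \<Longrightarrow> g B \<le> c" for A c
    unfolding V_def using that by (intro cSUP_least) auto
  have Vadd: "V (A \<union> B) = V A + V B" if A: "A \<in> sets M" and B: "B \<in> sets M" and AB: "A \<inter> B = {}" for A B
  proof (rule antisym)
    show "V (A \<union> B) \<le> V A + V B"
    proof (rule VI)
      fix C assume C: "C \<in> sets M" "C \<subseteq> A \<union> B"
      have "g C = g ((C \<inter> A) \<union> (C \<inter> B))" using C by (intro arg_cong[of _ _ g]) auto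
      also have "\<dots> = g (C \<inter> A) + g (C \<inter> B)" using A B C AB by (intro add) auto
      also have "\<dots> \<le> V A + V B" using A B C by (intro add_mono gV) auto
      finally show "g C \<le> V A + V B" .
    qed
    \<comment> \<open>The suprema over subsets of \<open>A\<close> and over subsets of
      \<open>B\<close> are resolved one after the other.\<close>
    have "V A \<le> V (A \<union> B) - V B"
    proof (rule VI)
      fix C assume C: "C \<in> sets M" "C \<subseteq> A"
      have "V B \<le> V (A \<union> B) - g C"
      proof (rule VI)
        fix D assume D: "D \<in> sets M" "D \<subseteq> B"
        have "g C + g D = g (C \<union> D)" using C D AB by (intro add[symmetric]) auto
        also have "\<dots> \<le> V (A \<union> B)" using C D A B by (intro gV) auto
        finally show "g D \<le> V (A \<union> B) - g C" by simp
      qed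
      then show "g C \<le> V (A \<union> B) - V B" by simp
    qed
    then show "V A + V B \<le> V (A \<union> B)" by simp
  qed
  have V0: "0 \<le> V A" if "A \<in> sets M" for A using gV[OF that, of "{}"] g0 by simp
  have Vb: "V A \<le> n * prob A powr (1 / p)" if "A \<in> sets M" for A
    by (rule VI) (use gV' that in auto)
  obtain Q where Q: "integrable M Q" "\<And>A. A \<in> sets M \<Longrightarrow> V A = (\<integral>x. indicator A x * Q x \<partial>M)"
    using nonneg_additive_density[OF p n V0 Vadd Vb] by blast
  have "0 \<le> V A - g A" if "A \<in> sets M" for A using gV[OF that that] by simp
  \<comment> \<open>\<open>V A\<close> and \<open>- g A\<close> contribute one \<open>n\<close>
    each.\<close>
  moreover have "V A - g A \<le> (2 * n) * prob A powr (1 / p)" if "A \<in> sets M" for A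
    using Vb[OF that] bound[OF that] by linarith
  ultimately obtain R where R: "integrable M R"
      "\<And>A. A \<in> sets M \<Longrightarrow> V A - g A = (\<integral>x. indicator A x * R x \<partial>M)"
    using nonneg_additive_density[OF p, of "2 * n" "\<lambda>A. V A - g A"] n Vadd add by auto
  have "g A = (\<integral>x. indicator A x * (Q x - R x) \<partial>M)" if A: "A \<in> sets M" for A
  proof -
    have "integrable M (\<lambda>x. indicator A x * Q x)" "integrable M (\<lambda>x. indicator A x * R x)"
      using integrable_mult_indicator[OF A Q(1)] integrable_mult_indicator[OF A R(1)] by auto
    then have "(\<integral>x. indicator A x * (Q x - R x) \<partial>M) = V A - (V A - g A)"
      using Q(2)[OF A] R(2)[OF A] by (simp add: right_diff_distrib)
    then show ?thesis by simp
  qed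
  then show ?thesis using that[of "\<lambda>x. Q x - R x"] Q R by auto
qed

text \<open>Applied to a difference and its negative, the one-sided bound makes \<open>f\<close>
  Lipschitz for the seminorm, in which dominated pointwise limits converge.\<close>

lemma linear_on_Lspace_tendsto:
  assumes p: "1 \<le> p" and n: "0 \<le> n"
    and lin: "linear_on (Lspace M (ennreal p)) f"
    and bd: "\<And>X. X \<in> Lspace M (ennreal p) \<Longrightarrow> f X \<le> n * Lnorm M p X"
    and W: "W \<in> Lspace M (ennreal p)"
    and meas: "\<And>i. U i \<in> borel_measurable M" "u \<in> borel_measurable M"
    and dom: "\<And>i x. x \<in> space M \<Longrightarrow> \<bar>U i x\<bar> \<le> \<bar>W x\<bar>"
    and lim: "\<And>x. x \<in> space M \<Longrightarrow> (\<lambda>i. U i x) \<longlonglongrightarrow> u x"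
  shows "(\<lambda>i. f (U i)) \<longlonglongrightarrow> f u"
proof -
  note fs = function_space_Lspace[OF p, of M]
  have "\<bar>u x\<bar> \<le> \<bar>W x\<bar>" if "x \<in> space M" for x
    by (rule LIMSEQ_le_const2[OF tendsto_rabs[OF lim[OF that]]]) (use dom[OF that] in auto)
  then have u: "u \<in> Lspace M (ennreal p)" by (intro Lspace_dominated[OF p W meas(2)])
  have U: "U i \<in> Lspace M (ennreal p)" for i by (intro Lspace_dominated[OF p W meas(1)] dom)
  have le: "\<bar>f (U i) - f u\<bar> \<le> n * Lnorm M p (\<lambda>x. U i x - u x)" for i
  proof -
    have d: "(\<lambda>x. U i x - u x) \<in> Lspace M (ennreal p)" by (rule function_space_diff[OF fs U u])
    have "f (\<lambda>x. U i x - u x) = f (U i) - f u" by (rule linear_on_diff[OF lin fs U u])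
    then show ?thesis
      using bd[OF d] bd[OF function_space_uminus[OF fs d]] linear_on_uminus[OF lin d]
        Lnorm_uminus[of M p "\<lambda>x. U i x - u x"] by (simp add: abs_le_iff)
  qed
  have "(\<lambda>i. n * Lnorm M p (\<lambda>x. U i x - u x)) \<longlonglongrightarrow> n * 0"
    by (intro tendsto_mult_left Lnorm_dominated_convergence[OF p W meas dom lim])
  then have lim0: "(\<lambda>i. n * Lnorm M p (\<lambda>x. U i x - u x)) \<longlonglongrightarrow> 0" by simp
  have "(\<lambda>i. f (U i) - f u) \<longlonglongrightarrow> 0"
    by (rule Lim_null_comparison[OF always_eventually lim0]) (simp add: le)
  then show ?thesis by (rule LIM_zero_cancel)
qed

text \<open>The values of \<open>f\<close> on indicators form a set function with a density, and
  induction over measurable functions carries the formula further. It stops at bounded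
  \<open>X\<close>: as long as \<open>Q\<close> is merely integrable, \<open>X * Q\<close> need not
  be.\<close>

lemma linear_on_Lspace_density:
  assumes p: "1 \<le> p" and n: "0 \<le> n"
    and lin: "linear_on (Lspace M (ennreal p)) f"
    and bd: "\<And>X. X \<in> Lspace M (ennreal p) \<Longrightarrow> f X \<le> n * Lnorm M p X"
  obtains Q where "integrable M Q"
    "\<And>X C. X \<in> borel_measurable M \<Longrightarrow> (\<And>x. x \<in> space M \<Longrightarrow> \<bar>X x\<bar> \<le> C) \<Longrightarrow>
      f X = (\<integral>x. X x * Q x \<partial>M)"
proof -
  note fs = function_space_Lspace[OF p, of M]
  have ind: "indicator A \<in> Lspace M (ennreal p)" if "A \<in> sets M" for A
    by (rule Lspace_bounded[OF p, of _ 1]) (use that in \<open>auto simp: indicator_def\<close>)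
  obtain Q where Q: "integrable M Q"
    and fQ: "\<And>A. A \<in> sets M \<Longrightarrow> f (indicator A) = (\<integral>x. indicator A x * Q x \<partial>M)"
  proof (rule additive_density[OF p n, of "\<lambda>A. f (indicator A)"])
    fix A B assume A: "A \<in> sets M" and B: "B \<in> sets M" and AB: "A \<inter> B = {}"
    have "indicator (A \<union> B) = (\<lambda>x. indicator A x + indicator B x :: real)"
      using AB by (auto simp: indicator_def fun_eq_iff)
    then show "f (indicator (A \<union> B)) = f (indicator A) + f (indicator B)"
      using linear_on_add[OF lin ind[OF A] ind[OF B]] by simp
  next
    fix A assume A: "A \<in> sets M"
    show "\<bar>f (indicator A)\<bar> \<le> n * prob A powr (1 / p)"
      using bd[OF ind[OF A]] bd[OF function_space_uminus[OF fs ind[OF A]]]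
        linear_on_uminus[OF lin ind[OF A]]
      by (simp add: Lnorm_uminus Lnorm_indicator[OF p A] abs_le_iff)
  qed blast
  note [measurable] = borel_measurable_integrable[OF Q]
  have bQ: "integrable M (\<lambda>x. u x * Q x)"
    if "u \<in> borel_measurable M" "\<And>x. x \<in> space M \<Longrightarrow> \<bar>u x\<bar> \<le> C" for u C
  proof (rule Bochner_Integration.integrable_bound[OF integrable_mult_right[OF integrable_abs[OF Q], of C]])
    show "AE x in M. norm (u x * Q x) \<le> norm (C * \<bar>Q x\<bar>)"
    proof (rule AE_I2)
      fix x assume "x \<in> space M"
      then have "\<bar>u x\<bar> \<le> \<bar>C\<bar>" using that(2) by force
      then show "norm (u x * Q x) \<le> norm (C * \<bar>Q x\<bar>)" by (simp add: abs_mult mult_right_mono)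
    qed
  qed (use that in measurable)
  \<comment> \<open>The bound is part of the induction formula, with \<open>C\<close> arbitrary,
    because the induction runs over all nonnegative measurable functions and the pieces may need
    another constant.\<close>
  have nonneg: "(\<forall>x\<in>space M. u x \<le> C) \<longrightarrow> f u = (\<integral>x. u x * Q x \<partial>M)"
    if "u \<in> borel_measurable M" "\<And>x. 0 \<le> u x" for u and C :: real
    using that
  proof (induction arbitrary: C rule: borel_measurable_induct_real)
    case (set A)
    then show ?case using fQ by blast
  next
    case (mult u c)
    show ?case
    proof
      assume *: "\<forall>x\<in>space M. c * u x \<le> C"
      show "f (\<lambda>x. c * u x) = (\<integral>x. c * u x * Q x \<partial>M)"
      \<comment> \<open>For \<open>c = 0\<close> the hypothesis says nothing about the size of
        \<open>u\<close> and \<open>C / c\<close> is no bound for it, but both sides are 0.\<close>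
      proof (cases "c = 0")
        case True
        then show ?thesis using linear_on_scale[OF lin Lspace_const[OF p], of 0 0] by simp
      next
        case False
        then have b: "\<forall>x\<in>space M. u x \<le> C / c"
          using * mult.hyps(1) by (simp add: field_simps)
        then have "u \<in> Lspace M (ennreal p)"
          using mult.hyps(2,3) by (intro Lspace_bounded[OF p, of _ "C / c"]) auto
        then have "f (\<lambda>x. c * u x) = c * f u" by (rule linear_on_scale[OF lin])
        then show ?thesis using mult.IH b by (simp add: mult.assoc)
      qed
    qed
  next
    case (add u v)
    show ?case
    proof
      assume *: "\<forall>x\<in>space M. v x + u x \<le> C"
      have b: "u x \<le> C" "v x \<le> C" if "x \<in> space M" for x
        using * that add.hyps(2,4)[of x] by force+
      have b': "\<bar>u x\<bar> \<le> C" "\<bar>v x\<bar> \<le> C" if "x \<in> space M" for x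
        using b[OF that] add.hyps(2,4)[of x] by simp_all
      have L: "u \<in> Lspace M (ennreal p)" "v \<in> Lspace M (ennreal p)"
        by (intro Lspace_bounded[OF p, of _ C] add.hyps(1,3) b'; assumption)+
      have "integrable M (\<lambda>x. u x * Q x)" "integrable M (\<lambda>x. v x * Q x)"
        by (intro bQ[of _ C] add.hyps(1,3) b'; assumption)+
      moreover have "f u = (\<integral>x. u x * Q x \<partial>M)" "f v = (\<integral>x. v x * Q x \<partial>M)"
        using add.IH[of C] b by blast+
      ultimately show "f (\<lambda>x. v x + u x) = (\<integral>x. (v x + u x) * Q x \<partial>M)"
        using linear_on_add[OF lin L(2,1)] by (simp add: distrib_right)
    qed
  next
    case (seq U)
    show ?case
    proof
      assume *: "\<forall>x\<in>space M. u x \<le> C"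
      have le: "U i x \<le> u x" if "x \<in> space M" for i x
        using seq.hyps(3) by (intro incseq_le[OF _ seq.hyps(4)[OF that]]) (auto simp: incseq_def le_fun_def)
      have b: "\<bar>U i x\<bar> \<le> \<bar>C\<bar>" if "x \<in> space M" for i x
        using le[OF that, of i] * that seq.hyps(2)[of i x] by force
      have "(\<lambda>i. f (U i)) \<longlonglongrightarrow> f u"
        by (rule linear_on_Lspace_tendsto[OF p n lin bd Lspace_const[OF p, of C] seq.hyps(1) that(1) b seq.hyps(4)])
      moreover have "(\<lambda>i. \<integral>x. U i x * Q x \<partial>M) \<longlonglongrightarrow> (\<integral>x. u x * Q x \<partial>M)"
      proof (rule integral_dominated_convergence)
        show "integrable M (\<lambda>x. \<bar>C\<bar> * \<bar>Q x\<bar>)" using Q by simp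
        show "AE x in M. (\<lambda>i. U i x * Q x) \<longlonglongrightarrow> u x * Q x"
          by (intro AE_I2 tendsto_mult_right seq.hyps(4))
        show "AE x in M. norm (U i x * Q x) \<le> \<bar>C\<bar> * \<bar>Q x\<bar>" for i
          using b by (intro AE_I2) (simp add: abs_mult mult_right_mono)
      qed (use seq.hyps(1) that(1) in measurable)
      moreover have "f (U i) = (\<integral>x. U i x * Q x \<partial>M)" for i
        using seq.IH[of i C] le * by (meson order_trans)
      ultimately show "f u = (\<integral>x. u x * Q x \<partial>M)"
        using LIMSEQ_unique by simp
    qed
  qed
  have "f X = (\<integral>x. X x * Q x \<partial>M)"
    if X[measurable]: "X \<in> borel_measurable M" and b: "\<And>x. x \<in> space M \<Longrightarrow> \<bar>X x\<bar> \<le> C" for X C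
  proof -
    let ?u = "\<lambda>x. max 0 (X x)" and ?v = "\<lambda>x. max 0 (- X x)"
    have b': "\<forall>x\<in>space M. ?u x \<le> \<bar>C\<bar>" "\<forall>x\<in>space M. ?v x \<le> \<bar>C\<bar>" using b by fastforce+
    have L: "?u \<in> Lspace M (ennreal p)" "?v \<in> Lspace M (ennreal p)"
      using b' by (auto intro!: Lspace_bounded[OF p, of _ "\<bar>C\<bar>"])
    have eq: "X = (\<lambda>x. ?u x - ?v x)" by auto
    have "f X = f ?u - f ?v" by (subst eq) (rule linear_on_diff[OF lin fs L])
    also have "f ?u = (\<integral>x. ?u x * Q x \<partial>M)" using nonneg[of ?u "\<bar>C\<bar>"] b' by simp
    also have "f ?v = (\<integral>x. ?v x * Q x \<partial>M)" using nonneg[of ?v "\<bar>C\<bar>"] b' by simp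
    also have "(\<integral>x. ?u x * Q x \<partial>M) - (\<integral>x. ?v x * Q x \<partial>M) = (\<integral>x. ?u x * Q x - ?v x * Q x \<partial>M)"
      using b' by (intro Bochner_Integration.integral_diff[symmetric] bQ[of _ "\<bar>C\<bar>"]) auto
    also have "\<dots> = (\<integral>x. X x * Q x \<partial>M)"
      by (intro Bochner_Integration.integral_cong) (auto simp: max_def)
    finally show ?thesis .
  qed
  then show ?thesis by (rule that[OF Q])
qed

section \<open>The density lies in the dual space, and the Riesz representation\<close>

lemma density_in_Lspace_infinity:
  assumes Q: "integrable M Q" and n: "0 \<le> n"
    and f: "\<And>X C. X \<in> borel_measurable M \<Longrightarrow> (\<And>x. x \<in> space M \<Longrightarrow> \<bar>X x\<bar> \<le> C) \<Longrightarrow>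
      (\<integral>x. X x * Q x \<partial>M) \<le> n * Lnorm M 1 X"
  shows "Q \<in> Lspace M \<infinity>"
proof -
  note [measurable] = borel_measurable_integrable[OF Q]
  let ?A = "{x\<in>space M. \<bar>Q x\<bar> > n}"
  \<comment> \<open>Tested with \<open>sgn Q\<close> on the set \<open>?A\<close>, the bound says
    that \<open>(|Q| - n)\<close> has integral at most 0 over \<open>?A\<close>. Being positive
    there, it forces \<open>?A\<close> to be null.\<close>
  let ?X = "\<lambda>x. if \<bar>Q x\<bar> > n then sgn (Q x) else 0"
  have i: "integrable M (\<lambda>x. indicator ?A x * \<bar>Q x\<bar>)" "integrable M (\<lambda>x. indicator ?A x * n)"
    using Q integrable_mult_indicator[OF _ integrable_abs[OF Q], of ?A]
      integrable_mult_indicator[of ?A M "\<lambda>_. n"] by auto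
  have "(\<integral>x. indicator ?A x * \<bar>Q x\<bar> \<partial>M) = (\<integral>x. ?X x * Q x \<partial>M)"
    by (intro Bochner_Integration.integral_cong) (auto simp: indicator_def abs_sgn mult.commute)
  also have "\<dots> \<le> n * Lnorm M 1 ?X"
    by (rule f[of _ 1]) (auto simp: sgn_if)
  also have "Lnorm M 1 ?X = (\<integral>x. indicator ?A x \<partial>M)"
    unfolding Lnorm_def using n
    by (simp del: integral_indicator Bochner_Integration.integral_indicator,
        intro Bochner_Integration.integral_cong) (auto simp: indicator_def sgn_if)
  also have "n * \<dots> = (\<integral>x. indicator ?A x * n \<partial>M)" by simp
  finally have "(\<integral>x. indicator ?A x * \<bar>Q x\<bar> - indicator ?A x * n \<partial>M) \<le> 0" using i by simp
  moreover have pos: "0 \<le> indicator ?A x * \<bar>Q x\<bar> - indicator ?A x * n" for x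
    by (auto simp: indicator_def)
  ultimately have "(\<integral>x. indicator ?A x * \<bar>Q x\<bar> - indicator ?A x * n \<partial>M) = 0"
    by (intro antisym integral_nonneg_AE) auto
  then have "AE x in M. indicator ?A x * \<bar>Q x\<bar> - indicator ?A x * n = 0"
    using integral_nonneg_eq_0_iff_AE[OF Bochner_Integration.integrable_diff[OF i]] pos by simp
  then have "AE x in M. \<bar>Q x\<bar> \<le> n"
    by (rule AE_mp) (rule AE_I2, auto simp: indicator_def)
  then show ?thesis unfolding Lspace_def by auto
qed

text \<open>The extremal function of Hoelder's inequality, \<open>sgn Q * |Q| powr (r - 1)\<close>,
  is the test function, cut off where \<open>|Q| > k\<close> so that it is bounded and
  \<open>I k\<close> is finite. It yields a bound on \<open>I k\<close> independent of
  \<open>k\<close>, and monotone convergence concludes.\<close>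

lemma density_in_Lspace:
  assumes Q: "integrable M Q" and n: "0 \<le> n" and pr: "1 < p" "1 < r" "1 / p + 1 / r = 1"
    and f: "\<And>X C. X \<in> borel_measurable M \<Longrightarrow> (\<And>x. x \<in> space M \<Longrightarrow> \<bar>X x\<bar> \<le> C) \<Longrightarrow>
      (\<integral>x. X x * Q x \<partial>M) \<le> n * Lnorm M p X"
  shows "Q \<in> Lspace M (ennreal r)"
proof -
  note [measurable] = borel_measurable_integrable[OF Q]
  \<comment> \<open>By this identity the \<open>p\<close>-th power of the test function is the
    truncated \<open>|Q| powr r\<close>.\<close>
  have rp: "(r - 1) * p = r" using pr by (simp add: field_simps)
  define I where "I k = (\<integral>x. (if \<bar>Q x\<bar> \<le> real k then \<bar>Q x\<bar> powr r else 0) \<partial>M)" for k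
  have int: "integrable M (\<lambda>x. if \<bar>Q x\<bar> \<le> real k then \<bar>Q x\<bar> powr r else 0)" for k
    using pr by (intro integrable_const_bound[where B = "real k powr r"])
      (auto intro!: AE_I2 powr_mono2)
  have I0: "0 \<le> I k" for k unfolding I_def by (intro integral_nonneg_AE) auto
  have Ik: "I k \<le> n powr r" for k
  proof -
    let ?X = "\<lambda>x. if \<bar>Q x\<bar> \<le> real k then sgn (Q x) * \<bar>Q x\<bar> powr (r - 1) else 0"
    have "?X x * Q x = (if \<bar>Q x\<bar> \<le> real k then \<bar>Q x\<bar> powr r else 0)" for x
    proof -
      have "\<bar>Q x\<bar> powr (r - 1) * \<bar>Q x\<bar> = \<bar>Q x\<bar> powr r"
        using pr by (cases "Q x = 0") (simp_all add: powr_diff)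
      moreover have "sgn (Q x) * \<bar>Q x\<bar> powr (r - 1) * Q x = \<bar>Q x\<bar> powr (r - 1) * \<bar>Q x\<bar>"
        by (simp add: abs_sgn)
      ultimately show ?thesis by simp
    qed
    then have "I k = (\<integral>x. ?X x * Q x \<partial>M)" unfolding I_def by simp
    also have "\<dots> \<le> n * Lnorm M p ?X"
    proof (rule f[of _ "real k powr (r - 1)"])
      show "\<bar>?X x\<bar> \<le> real k powr (r - 1)" for x
        using pr by (auto simp: abs_mult sgn_if intro!: powr_mono2)
    qed measurable
    also have "Lnorm M p ?X = I k powr (1 / p)"
    proof -
      have "\<bar>?X x\<bar> powr p = (if \<bar>Q x\<bar> \<le> real k then \<bar>Q x\<bar> powr r else 0)" for x
        using pr rp by (auto simp: abs_mult sgn_if powr_powr)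
      then show ?thesis unfolding Lnorm_def I_def by simp
    qed
    finally have le: "I k \<le> n * I k powr (1 / p)" .
    show ?thesis
    proof (cases "I k = 0")
      case False
      then have pos: "I k > 0" using I0[of k] by simp
      \<comment> \<open>Here \<open>1 / r = 1 - 1 / p\<close>, and dividing the estimate
        \<open>le\<close> requires \<open>I k\<close> to be positive.\<close>
      have "I k powr (1 / r) = I k / I k powr (1 / p)"
        using pr(3) pos by (simp add: eq_diff_eq[symmetric] add.commute powr_diff)
      also have "\<dots> \<le> n" using le pos by (simp add: divide_le_eq)
      finally have "(I k powr (1 / r)) powr r \<le> n powr r" using pr by (intro powr_mono2) auto
      then show ?thesis using pos pr by (simp add: powr_powr)
    qed simp
  qed
  have mono: "(if \<bar>Q x\<bar> \<le> real k then \<bar>Q x\<bar> powr r else 0) \<le>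
      (if \<bar>Q x\<bar> \<le> real l then \<bar>Q x\<bar> powr r else 0)" if "k \<le> l" for k l x
    using that by auto
  have "incseq I" unfolding I_def incseq_def by (auto intro!: integral_mono int mono)
  then obtain L where L: "I \<longlonglongrightarrow> L" using incseq_convergent[of I "n powr r"] Ik by blast
  have "integrable M (\<lambda>x. \<bar>Q x\<bar> powr r)"
  proof (rule integrable_monotone_convergence)
    show "AE x in M. mono (\<lambda>k::nat. if \<bar>Q x\<bar> \<le> real k then \<bar>Q x\<bar> powr r else 0)"
      by (intro AE_I2 monoI mono)
    show "AE x in M. (\<lambda>k::nat. if \<bar>Q x\<bar> \<le> real k then \<bar>Q x\<bar> powr r else 0) \<longlonglongrightarrow> \<bar>Q x\<bar> powr r"
    proof (rule AE_I2)
      fix x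
      obtain k where k: "\<bar>Q x\<bar> \<le> real k" using real_arch_simple by blast
      show "(\<lambda>k::nat. if \<bar>Q x\<bar> \<le> real k then \<bar>Q x\<bar> powr r else 0) \<longlonglongrightarrow> \<bar>Q x\<bar> powr r"
        by (rule tendsto_eventually, rule eventually_sequentiallyI[of k]) (use k in auto)
    qed
    show "(\<lambda>k. \<integral>x. (if \<bar>Q x\<bar> \<le> real k then \<bar>Q x\<bar> powr r else 0) \<partial>M) \<longlonglongrightarrow> L"
      using L unfolding I_def .
  qed (use int in auto)
  then show ?thesis using pr by (simp add: Lspace_iff)
qed

text \<open>The order matters: testing with bounded functions first puts \<open>Q\<close> into
  \<open>Lspace M q\<close>, this makes \<open>X * Q\<close> integrable, and only then can
  truncation of \<open>X\<close> extend the formula to the whole space.\<close>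

theorem Lspace_riesz_representation:
  assumes p: "1 \<le> p" and pq: "1 / ennreal p + 1 / q = 1" and n: "0 \<le> n"
    and lin: "linear_on (Lspace M (ennreal p)) f"
    and bd: "\<And>X. X \<in> Lspace M (ennreal p) \<Longrightarrow> f X \<le> n * Lnorm M p X"
  obtains Q where "Q \<in> Lspace M q" "\<And>X. X \<in> Lspace M (ennreal p) \<Longrightarrow> f X = (\<integral>x. X x * Q x \<partial>M)"
proof -
  obtain Q where Q: "integrable M Q"
    and f: "\<And>X C. X \<in> borel_measurable M \<Longrightarrow> (\<And>x. x \<in> space M \<Longrightarrow> \<bar>X x\<bar> \<le> C) \<Longrightarrow>
      f X = (\<integral>x. X x * Q x \<partial>M)"
    using linear_on_Lspace_density[OF p n lin bd] by blast
  have le: "(\<integral>x. X x * Q x \<partial>M) \<le> n * Lnorm M p X"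
    if "X \<in> borel_measurable M" "\<And>x. x \<in> space M \<Longrightarrow> \<bar>X x\<bar> \<le> C" for X C
    using f[OF that] bd[OF Lspace_bounded[OF p that]] by simp
  have Qq: "Q \<in> Lspace M q"
  proof (rule conjugate_exponents_cases[OF p pq])
    show "Q \<in> Lspace M q" if "p = 1" "q = \<infinity>"
      unfolding that(2) by (rule density_in_Lspace_infinity[OF Q n]) (use le[unfolded that(1)] in blast)
    show "Q \<in> Lspace M q" if "1 < p" "1 < r" "1 / p + 1 / r = 1" "q = ennreal r" for r
      unfolding that(4) by (rule density_in_Lspace[OF Q n that(1-3)]) (use le in blast)
  qed
  note [measurable] = borel_measurable_integrable[OF Q]
  have "f X = (\<integral>x. X x * Q x \<partial>M)" if X: "X \<in> Lspace M (ennreal p)" for X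
  proof -
    note [measurable] = Lspace_measurable[OF X]
    define U where "U k x = (if \<bar>X x\<bar> \<le> real k then X x else 0)" for k x
    have Um[measurable]: "U k \<in> borel_measurable M" for k unfolding U_def by measurable
    have lim: "(\<lambda>k. U k x) \<longlonglongrightarrow> X x" for x
    proof -
      obtain k where k: "\<bar>X x\<bar> \<le> real k" using real_arch_simple by blast
      show ?thesis unfolding U_def
        by (rule tendsto_eventually, rule eventually_sequentiallyI[of k]) (use k in auto)
    qed
    have dom: "\<bar>U k x\<bar> \<le> \<bar>X x\<bar>" for k x unfolding U_def by simp
    have "(\<lambda>k. f (U k)) \<longlonglongrightarrow> f X"
      by (rule linear_on_Lspace_tendsto[OF p n lin bd X Um Lspace_measurable[OF X] dom lim])
    moreover have "(\<lambda>k. \<integral>x. U k x * Q x \<partial>M) \<longlonglongrightarrow> (\<integral>x. X x * Q x \<partial>M)"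
    proof (rule integral_dominated_convergence)
      show "integrable M (\<lambda>x. \<bar>X x * Q x\<bar>)" using Holder_integrable[OF p pq X Qq] by simp
      show "AE x in M. (\<lambda>k. U k x * Q x) \<longlonglongrightarrow> X x * Q x"
        by (intro AE_I2 tendsto_mult_right lim)
      show "AE x in M. norm (U k x * Q x) \<le> \<bar>X x * Q x\<bar>" for k
        using dom by (intro AE_I2) (simp add: abs_mult mult_right_mono)
    qed measurable
    moreover have "f (U k) = (\<integral>x. U k x * Q x \<partial>M)" for k
      by (rule f[of _ "real k"]) (auto simp: U_def)
    ultimately show ?thesis using LIMSEQ_unique by simp
  qed
  then show ?thesis by (rule that[OF Qq])
qed

end

section \<open>The Fenchel--Moreau inequality and its consequences\<close>

lemma closed_functional_lower_bound:
  assumes F: "closed_functional M p F" and X: "X \<in> Lspace M (ennreal p)" and a: "ereal a < F X"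
  obtains e where "e > 0"
    "\<And>Y. Y \<in> Lspace M (ennreal p) \<Longrightarrow> Lnorm M p (\<lambda>x. Y x - X x) < e \<Longrightarrow> ereal a < F Y"
proof -
  let ?L = "Lspace M (ennreal p)"
  have "openin (Ltopology M p) (?L - {X \<in> ?L. F X \<le> ereal a})"
    using F unfolding closed_functional_def closedin_def topspace_Ltopology by blast
  moreover have "X \<in> ?L - {X \<in> ?L. F X \<le> ereal a}" using X a by auto
  ultimately obtain e where "e > 0"
      "\<forall>Y\<in>?L. Lnorm M p (\<lambda>x. Y x - X x) < e \<longrightarrow> Y \<in> ?L - {X \<in> ?L. F X \<le> ereal a}"
    unfolding openin_Ltopology by blast
  then show ?thesis by (intro that[of e]) (auto simp: not_le)
qed

text \<open>
  On a ball around a point where \<open>F\<close> is finite, \<open>F\<close> is bounded below; convexity along rays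
  from that point turns this into a linear bound in the norm.
\<close>

lemma closed_convex_norm_minorant:
  assumes p: "1 \<le> p" and proper: "proper_functional M p F"
    and cl: "closed_functional M p F" and conv: "convex_functional M p F"
  obtains X1 c m where "X1 \<in> Lspace M (ennreal p)" "m \<ge> 0"
    "\<And>Y. Y \<in> Lspace M (ennreal p) \<Longrightarrow> ereal (c - m * Lnorm M p (\<lambda>x. Y x - X1 x)) \<le> F Y"
proof -
  let ?L = "Lspace M (ennreal p)"
  obtain X1 where X1: "X1 \<in> ?L" "F X1 < \<infinity>" using proper unfolding proper_functional_def by auto
  have ninf: "F Y \<noteq> -\<infinity>" if "Y \<in> ?L" for Y using proper that unfolding proper_functional_def by auto
  obtain c where c: "F X1 = ereal c" using X1 ninf by (cases "F X1") auto
  \<comment> \<open>The level \<open>c - 1\<close> is an arbitrary one strictly below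
    \<open>F X1\<close>.\<close>
  obtain e where e: "e > 0"
    "\<And>Y. Y \<in> ?L \<Longrightarrow> Lnorm M p (\<lambda>x. Y x - X1 x) < e \<Longrightarrow> ereal (c - 1) < F Y"
    using closed_functional_lower_bound[OF cl X1(1), of "c - 1"] c by auto
  have "ereal ((c - 1) - 2 / e * Lnorm M p (\<lambda>x. Y x - X1 x)) \<le> F Y" if Y: "Y \<in> ?L" for Y
  proof (cases "F Y")
    case (real y)
    define r where "r = Lnorm M p (\<lambda>x. Y x - X1 x)"
    show ?thesis
    proof (cases "r < e")
      case True
      then have "c - 1 < y" using e(2)[OF Y] real unfolding r_def by simp
      moreover have "0 \<le> 2 / e * r" using e(1) Lnorm_nonneg[of M p] unfolding r_def by simp
      ultimately have "(c - 1) - 2 / e * r \<le> y" by linarith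
      then show ?thesis using real unfolding r_def by simp
    next
      case False
      \<comment> \<open>This puts \<open>?Z\<close> at distance \<open>e / 2\<close> from
        \<open>X1\<close>, inside the ball where \<open>F\<close> exceeds \<open>c - 1\<close>; the
        inverse of \<open>t\<close> is the source of the slope \<open>2 / e\<close>.\<close>
      define t where "t = e / (2 * r)"
      have t: "0 < t" "t < 1" "t * r < e" using e(1) False unfolding t_def by (auto simp: field_simps)
      let ?Z = "\<lambda>x. (1 - t) * X1 x + t * Y x"
      have Z: "?Z \<in> ?L" by (intro Lspace_add Lspace_scale p X1 Y)
      have "(\<lambda>x. ?Z x - X1 x) = (\<lambda>x. t * (Y x - X1 x))" by (auto simp: algebra_simps)
      then have "Lnorm M p (\<lambda>x. ?Z x - X1 x) = t * r"
        unfolding r_def using t Lnorm_scale[OF p, of M t "\<lambda>x. Y x - X1 x"] by simp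
      then have "ereal (c - 1) < F ?Z" using e(2)[OF Z] t by simp
      also have "F ?Z \<le> ereal (1 - t) * F X1 + ereal t * F Y"
        using conv X1(1) Y t unfolding convex_functional_def by blast
      also have "\<dots> = ereal ((1 - t) * c + t * y)" using c real by simp
      finally have "t * (c - y) < 1" by (simp add: algebra_simps)
      then have "c - y < 1 / t" using t by (simp add: field_simps)
      moreover have "1 / t = 2 / e * r" unfolding t_def by simp
      ultimately show ?thesis using real unfolding r_def by simp
    qed
  qed (use ninf[OF Y] in auto)
  then show ?thesis using that[OF X1(1), of "2 / e" "c - 1"] e(1) by auto
qed

text \<open>Near \<open>X0\<close> the bound \<open>a\<close> comes from closedness. Far away, the
  bound centred at \<open>X1\<close> is recentred by the triangle inequality and the slope is
  increased.\<close>

lemma closed_convex_norm_minorant_at: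
  assumes p: "1 \<le> p" and proper: "proper_functional M p F"
    and cl: "closed_functional M p F" and conv: "convex_functional M p F"
    and X0: "X0 \<in> Lspace M (ennreal p)" and a: "ereal a < F X0"
  obtains n where "n \<ge> 0"
    "\<And>Y. Y \<in> Lspace M (ennreal p) \<Longrightarrow> ereal (a - n * Lnorm M p (\<lambda>x. Y x - X0 x)) \<le> F Y"
proof -
  let ?L = "Lspace M (ennreal p)"
  obtain X1 c m where X1: "X1 \<in> ?L" and m: "m \<ge> 0"
    and low: "\<And>Y. Y \<in> ?L \<Longrightarrow> ereal (c - m * Lnorm M p (\<lambda>x. Y x - X1 x)) \<le> F Y"
    by (rule closed_convex_norm_minorant[OF p proper cl conv]) (rule that; assumption)
  obtain d where d: "d > 0"
    "\<And>Y. Y \<in> ?L \<Longrightarrow> Lnorm M p (\<lambda>x. Y x - X0 x) < d \<Longrightarrow> ereal a < F Y"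
    using closed_functional_lower_bound[OF cl X0 a] by blast
  define s where "s = Lnorm M p (\<lambda>x. X0 x - X1 x)"
  \<comment> \<open>The extra slope absorbs \<open>a - c + m * s\<close>, the excess left by
    recentring, at every distance of at least \<open>d\<close>.\<close>
  define n where "n = m + \<bar>a - c + m * s\<bar> / d"
  have n: "n \<ge> 0" using m d unfolding n_def by simp
  have "ereal (a - n * Lnorm M p (\<lambda>x. Y x - X0 x)) \<le> F Y" if Y: "Y \<in> ?L" for Y
  proof -
    define r where "r = Lnorm M p (\<lambda>x. Y x - X0 x)"
    have r: "r \<ge> 0" unfolding r_def by (rule Lnorm_nonneg)
    show ?thesis
    proof (cases "r < d")
      case True
      then have "ereal a < F Y" using d(2)[OF Y] unfolding r_def by simp
      moreover have "a - n * r \<le> a" using n r by simp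
      ultimately show ?thesis unfolding r_def by (meson ereal_less_eq(3) less_imp_le order_trans)
    next
      case False
      note fs = function_space_Lspace[OF p, of M]
      have "Lnorm M p (\<lambda>x. (Y x - X0 x) + (X0 x - X1 x)) \<le> r + s"
        unfolding r_def s_def by (intro Lnorm_triangle p function_space_diff[OF fs] Y X0 X1)
      then have "m * Lnorm M p (\<lambda>x. Y x - X1 x) \<le> m * (r + s)"
        using m by (intro mult_left_mono) simp_all
      moreover have "\<bar>a - c + m * s\<bar> \<le> \<bar>a - c + m * s\<bar> / d * r"
        using False d mult_left_mono[of d r "\<bar>a - c + m * s\<bar>"] by (simp add: field_simps)
      ultimately have "a - n * r \<le> c - m * Lnorm M p (\<lambda>x. Y x - X1 x)"
        unfolding n_def by (simp add: algebra_simps)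
      then show ?thesis using low[OF Y] unfolding r_def by (meson ereal_less_eq(3) order_trans)
    qed
  qed
  then show ?thesis using that[OF n] by blast
qed

lemma conjugate_upper: "X \<in> Lspace M p \<Longrightarrow> ereal (\<integral>x. X x * Q x \<partial>M) - F X \<le> conjugate M p F Q"
  unfolding conjugate_def by (rule SUP_upper)

context prob_space
begin

theorem fenchel_moreau:
  assumes p: "1 \<le> p" and pq: "1 / ennreal p + 1 / q = 1"
    and proper: "proper_functional M p F"
    and cl: "closed_functional M p F" and conv: "convex_functional M p F"
    and X0: "X0 \<in> Lspace M (ennreal p)" and a: "ereal a < F X0"
  obtains Q where "Q \<in> conjugate_domain M p q F"
    "conjugate M p F Q \<le> ereal ((\<integral>x. X0 x * Q x \<partial>M) - a)"
proof -
  let ?L = "Lspace M (ennreal p)"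
  note fs = function_space_Lspace[OF p, of M]
  obtain n where n: "n \<ge> 0"
    and low: "\<And>Y. Y \<in> ?L \<Longrightarrow> ereal (a - n * Lnorm M p (\<lambda>x. Y x - X0 x)) \<le> F Y"
    using closed_convex_norm_minorant_at[OF p proper cl conv X0 a] by blast
  have ninf: "F Y \<noteq> -\<infinity>" if "Y \<in> ?L" for Y using proper that unfolding proper_functional_def by auto
  \<comment> \<open>Translation by \<open>X0\<close> brings the minorant into the form required by
    \<open>linear_sandwich\<close>. \<open>D\<close> keeps only finite values, since
    \<open>real_of_ereal\<close> would send infinity to 0.\<close>
  define D where "D = {Z \<in> ?L. F (\<lambda>x. X0 x + Z x) < \<infinity>}"
  define k where "k Z = real_of_ereal (F (\<lambda>x. X0 x + Z x)) - a" for Z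
  have sh: "(\<lambda>x. X0 x + Z x) \<in> ?L" if "Z \<in> ?L" for Z by (intro Lspace_add p X0 that)
  have Fk: "F (\<lambda>x. X0 x + Z x) = ereal (k Z + a)" if "Z \<in> D" for Z
    using that ninf[OF sh[of Z]] unfolding D_def k_def by (cases "F (\<lambda>x. X0 x + Z x)") auto
  have inD: "(\<lambda>x. X x - X0 x) \<in> D" if "X \<in> ?L" "F X < \<infinity>" for X
    using that function_space_diff[OF fs that(1) X0] unfolding D_def by simp
  obtain f where lin: "linear_on ?L f" and fN: "\<And>X. X \<in> ?L \<Longrightarrow> f X \<le> n * Lnorm M p X"
    and fk: "\<And>X. X \<in> D \<Longrightarrow> f X \<le> k X"
  proof (rule linear_sandwich[OF fs sublinear_on_Lnorm[OF p n]])
    show "D \<subseteq> ?L" unfolding D_def by auto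
    show "D \<noteq> {}" using proper inD unfolding proper_functional_def by blast
    fix X Y :: "'a \<Rightarrow> real" and t :: real
    assume X: "X \<in> D" and Y: "Y \<in> D" and t: "0 \<le> t" "t \<le> 1"
    let ?Z = "\<lambda>x. (1 - t) * X x + t * Y x"
    have L: "X \<in> ?L" "Y \<in> ?L" using X Y unfolding D_def by auto
    have Z: "?Z \<in> ?L" by (intro Lspace_add Lspace_scale p L)
    have le: "F (\<lambda>x. X0 x + ?Z x) \<le> ereal ((1 - t) * (k X + a) + t * (k Y + a))"
    \<comment> \<open>\<open>convex_functional\<close> speaks of \<open>0 < t < 1\<close> only; at
      the endpoints \<open>?Z\<close> is \<open>X\<close> or \<open>Y\<close>.\<close>
    proof (cases "t = 0 \<or> t = 1")
      case True
      then show ?thesis using Fk[OF X] Fk[OF Y] by auto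
    next
      case False
      have "(\<lambda>x. X0 x + ?Z x) = (\<lambda>x. (1 - t) * (X0 x + X x) + t * (X0 x + Y x))"
        by (auto simp: algebra_simps)
      moreover have "0 < t \<and> t < 1" using False t by auto
      ultimately have "F (\<lambda>x. X0 x + ?Z x) \<le>
          ereal (1 - t) * F (\<lambda>x. X0 x + X x) + ereal t * F (\<lambda>x. X0 x + Y x)"
        using conv sh[OF L(1)] sh[OF L(2)] unfolding convex_functional_def by simp
      then show ?thesis using Fk[OF X] Fk[OF Y] by simp
    qed
    then have "?Z \<in> D" using Z unfolding D_def by auto
    moreover have "k ?Z \<le> (1 - t) * k X + t * k Y"
      using le Fk[OF \<open>?Z \<in> D\<close>] by (simp add: algebra_simps)
    ultimately show "?Z \<in> D \<and> k ?Z \<le> (1 - t) * k X + t * k Y" by blast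
  next
    fix Z assume Z: "Z \<in> D"
    then have "ereal (a - n * Lnorm M p (\<lambda>x. (X0 x + Z x) - X0 x)) \<le> F (\<lambda>x. X0 x + Z x)"
      unfolding D_def by (intro low sh) auto
    then show "- (n * Lnorm M p Z) \<le> k Z" using Fk[OF Z] by simp
  qed (auto simp: Lnorm_uminus)
  obtain Q where Q: "Q \<in> Lspace M q" and fQ: "\<And>X. X \<in> ?L \<Longrightarrow> f X = (\<integral>x. X x * Q x \<partial>M)"
    using Lspace_riesz_representation[OF p pq n lin fN] by blast
  have le: "conjugate M p F Q \<le> ereal ((\<integral>x. X0 x * Q x \<partial>M) - a)"
    unfolding conjugate_def
  proof (rule SUP_least)
    fix X assume X: "X \<in> ?L"
    \<comment> \<open>Where \<open>F\<close> is finite this is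
      \<open>f X - f X0 \<le> F X - a\<close> rearranged; elsewhere the left side is minus
      infinity.\<close>
    show "ereal (\<integral>x. X x * Q x \<partial>M) - F X \<le> ereal ((\<integral>x. X0 x * Q x \<partial>M) - a)"
    proof (cases "F X < \<infinity>")
      case True
      have "f X - f X0 = f (\<lambda>x. X x - X0 x)" by (rule linear_on_diff[OF lin fs X X0, symmetric])
      also have "\<dots> \<le> k (\<lambda>x. X x - X0 x)" by (rule fk[OF inD[OF X True]])
      finally have "(\<integral>x. X x * Q x \<partial>M) - (\<integral>x. X0 x * Q x \<partial>M) \<le> k (\<lambda>x. X x - X0 x)"
        using fQ[OF X] fQ[OF X0] by simp
      then show ?thesis using Fk[OF inD[OF X True]] by simp
    qed simp
  qed
  then have "conjugate M p F Q < \<infinity>" using le_less_trans by fastforce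
  then have "Q \<in> conjugate_domain M p q F" using Q unfolding conjugate_domain_def by simp
  then show ?thesis using le by (rule that)
qed

section \<open>Lower bounds, strictness on rays and values at constants, read off the
  conjugate\<close>

context
  fixes p :: real and q :: ennreal and F :: "('a \<Rightarrow> real) \<Rightarrow> ereal" and c :: real
  assumes p: "1 \<le> p" and pq: "1 / ennreal p + 1 / q = 1"
    and proper: "proper_functional M p F"
    and cl: "closed_functional M p F" and conv: "convex_functional M p F"
begin

text \<open>The bound on \<open>F\<close> is \<open>F\<^sup>* c \<le> 0\<close> spelled out. The
  rest is the relation between \<open>F 0\<close> and the infimum of \<open>F\<^sup>*\<close>: a
  value \<open>a\<close> strictly between 0 and \<open>F 0\<close> would produce some
  \<open>Q\<close> with \<open>F\<^sup>* Q \<le> - a\<close>, while \<open>F 0 = 0\<close> makes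
  \<open>F\<^sup>*\<close> nonnegative.\<close>

lemma conjugate_minimum_iff:
  "(\<forall>Q\<in>Lspace M q. conjugate M p F (\<lambda>_. c) \<le> conjugate M p F Q) \<and> conjugate M p F (\<lambda>_. c) = 0 \<longleftrightarrow>
   (\<forall>X\<in>Lspace M p. ereal (c * (\<integral>x. X x \<partial>M)) \<le> F X) \<and> F (\<lambda>_. 0) = 0"
proof (intro iffI conjI ballI)
  assume *: "(\<forall>Q\<in>Lspace M q. conjugate M p F (\<lambda>_. c) \<le> conjugate M p F Q) \<and> conjugate M p F (\<lambda>_. c) = 0"
  show low: "ereal (c * (\<integral>x. X x \<partial>M)) \<le> F X" if "X \<in> Lspace M p" for X
    using conjugate_upper[OF that, of "\<lambda>_. c" F] * by (cases "F X") (auto simp: mult.commute)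
  show "F (\<lambda>_. 0) = 0"
  proof (rule antisym)
    show "0 \<le> F (\<lambda>_. 0)" using low[OF Lspace_const[OF p], of 0] by (simp add: zero_ereal_def)
    show "F (\<lambda>_. 0) \<le> 0"
    proof (rule ccontr)
      assume "\<not> F (\<lambda>_. 0) \<le> 0"
      then obtain a where a: "0 < ereal a" "ereal a < F (\<lambda>_. 0)" using ereal_dense2 not_le by metis
      obtain Q where Q: "Q \<in> conjugate_domain M p q F" "conjugate M p F Q \<le> ereal ((\<integral>x. 0 * Q x \<partial>M) - a)"
        using fenchel_moreau[OF p pq proper cl conv Lspace_const[OF p] a(2)] by blast
      have "Q \<in> Lspace M q" using Q(1) unfolding conjugate_domain_def by simp
      then have "0 \<le> conjugate M p F Q" using * by auto
      then have "0 \<le> ereal ((\<integral>x. 0 * Q x \<partial>M) - a)" using Q(2) by (rule order_trans)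
      then show False using a by (simp add: zero_ereal_def)
    qed
  qed
next
  assume *: "(\<forall>X\<in>Lspace M p. ereal (c * (\<integral>x. X x \<partial>M)) \<le> F X) \<and> F (\<lambda>_. 0) = 0"
  then have F0: "F (\<lambda>_. 0) = 0" by (rule conjunct2)
  have ge: "0 \<le> conjugate M p F Q" for Q
    using conjugate_upper[OF Lspace_const[OF p], of 0 Q F] F0 by (simp add: zero_ereal_def)
  have "conjugate M p F (\<lambda>_. c) \<le> 0"
    unfolding conjugate_def
  proof (rule SUP_least)
    fix X assume "X \<in> Lspace M p"
    then have "ereal (c * (\<integral>x. X x \<partial>M)) \<le> F X" using * by blast
    then show "ereal (\<integral>x. X x * c \<partial>M) - F X \<le> 0"
      by (cases "F X") (auto simp: mult.commute)
  qed
  then show "conjugate M p F (\<lambda>_. c) = 0" using ge by (rule antisym)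
  then show "conjugate M p F (\<lambda>_. c) \<le> conjugate M p F Q" for Q using ge by simp
qed

text \<open>From left to right, a level \<open>a\<close> strictly between the two sides gives
  \<open>0 \<le> F\<^sup>* Q \<le> l E[X Q] - a\<close>. From right to left,
  \<open>F (l X) \<ge> l E[X Q] - F\<^sup>* Q\<close>: the gain over \<open>l c E[X]\<close> grows
  linearly in \<open>l\<close>, while the loss \<open>F\<^sup>* Q\<close> is a fixed finite
  number.\<close>

lemma exceeds_on_ray_iff:
  assumes F: "\<forall>X\<in>Lspace M p. ereal (c * (\<integral>x. X x \<partial>M)) \<le> F X" "F (\<lambda>_. 0) = 0"
    and X: "X \<in> Lspace M p"
  shows "(\<exists>l>0. ereal (c * (\<integral>x. l * X x \<partial>M)) < F (\<lambda>x. l * X x)) \<longleftrightarrow>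
    (\<exists>Q\<in>conjugate_domain M p q F. c * (\<integral>x. X x \<partial>M) < (\<integral>x. X x * Q x \<partial>M))"
proof
  have ge: "0 \<le> conjugate M p F Q" for Q
    using conjugate_upper[OF Lspace_const[OF p], of 0 Q F] F(2) by (simp add: zero_ereal_def)
  have lX: "(\<lambda>x. l * X x) \<in> Lspace M p" for l by (rule Lspace_scale[OF p X])
  {
    assume "\<exists>l>0. ereal (c * (\<integral>x. l * X x \<partial>M)) < F (\<lambda>x. l * X x)"
    then obtain l a where l: "l > 0" "c * (\<integral>x. l * X x \<partial>M) < a" and a: "ereal a < F (\<lambda>x. l * X x)"
      by (meson ereal_dense2 ereal_less(1) less_ereal.simps(1))
    obtain Q where Q: "Q \<in> conjugate_domain M p q F"
      "conjugate M p F Q \<le> ereal ((\<integral>x. l * X x * Q x \<partial>M) - a)"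
      using fenchel_moreau[OF p pq proper cl conv lX a] by blast
    have "0 \<le> ereal ((\<integral>x. l * X x * Q x \<partial>M) - a)" using ge Q(2) by (rule order_trans)
    then have "a \<le> l * (\<integral>x. X x * Q x \<partial>M)" by (simp add: mult.assoc zero_ereal_def)
    moreover have "c * (\<integral>x. l * X x \<partial>M) = l * (c * (\<integral>x. X x \<partial>M))" by simp
    ultimately have "l * (c * (\<integral>x. X x \<partial>M)) < l * (\<integral>x. X x * Q x \<partial>M)" using l(2) by linarith
    then show "\<exists>Q\<in>conjugate_domain M p q F. c * (\<integral>x. X x \<partial>M) < (\<integral>x. X x * Q x \<partial>M)"
      using l Q by auto
  }
  assume "\<exists>Q\<in>conjugate_domain M p q F. c * (\<integral>x. X x \<partial>M) < (\<integral>x. X x * Q x \<partial>M)"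
  then obtain Q where Q: "conjugate M p F Q < \<infinity>" and less: "c * (\<integral>x. X x \<partial>M) < (\<integral>x. X x * Q x \<partial>M)"
    unfolding conjugate_domain_def by auto
  obtain r where r: "conjugate M p F Q = ereal r" "r \<ge> 0" using Q ge[of Q] by (cases "conjugate M p F Q") auto
  \<comment> \<open>Chosen so that the gain is \<open>r + 1\<close>, just more than the loss
    \<open>r\<close>.\<close>
  define l where "l = (r + 1) / ((\<integral>x. X x * Q x \<partial>M) - c * (\<integral>x. X x \<partial>M))"
  have l: "l > 0" "l * ((\<integral>x. X x * Q x \<partial>M) - c * (\<integral>x. X x \<partial>M)) = r + 1"
    using less r unfolding l_def by auto
  have "ereal (\<integral>x. l * X x * Q x \<partial>M) - F (\<lambda>x. l * X x) \<le> ereal r"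
    using conjugate_upper[OF lX, of l Q F] r by simp
  then have "ereal (l * (\<integral>x. X x * Q x \<partial>M)) - F (\<lambda>x. l * X x) \<le> ereal r" by (simp add: mult.assoc)
  moreover have "c * (\<integral>x. l * X x \<partial>M) < l * (\<integral>x. X x * Q x \<partial>M) - r"
    using l(2) by (simp add: right_diff_distrib mult.left_commute)
  ultimately have "ereal (c * (\<integral>x. l * X x \<partial>M)) < F (\<lambda>x. l * X x)"
    by (cases "F (\<lambda>x. l * X x)") auto
  then show "\<exists>l>0. ereal (c * (\<integral>x. l * X x \<partial>M)) < F (\<lambda>x. l * X x)" using l by blast
qed

text \<open>From left to right, \<open>b * (E[Q] - c)\<close> stays below \<open>F\<^sup>* Q\<close>
  for every real \<open>b\<close>, so its slope vanishes. From right to left, if \<open>F\<close>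
  exceeded \<open>c * b\<close> at the constant \<open>b\<close>, a level \<open>a\<close> in
  between would satisfy \<open>a \<le> b E[Q] = c * b\<close>.\<close>

lemma constants_iff:
  assumes F: "\<forall>X\<in>Lspace M p. ereal (c * (\<integral>x. X x \<partial>M)) \<le> F X" "F (\<lambda>_. 0) = 0"
  shows "(\<forall>b::real. F (\<lambda>_. b) = ereal (c * b)) \<longleftrightarrow>
    (\<forall>Q\<in>conjugate_domain M p q F. (\<integral>x. Q x \<partial>M) = c)"
proof (intro iffI allI ballI)
  have ge: "0 \<le> conjugate M p F Q" for Q
    using conjugate_upper[OF Lspace_const[OF p], of 0 Q F] F(2) by (simp add: zero_ereal_def)
  {
    fix Q assume *: "\<forall>b::real. F (\<lambda>_. b) = ereal (c * b)" and "Q \<in> conjugate_domain M p q F"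
    then have Q: "conjugate M p F Q < \<infinity>" unfolding conjugate_domain_def by auto
    obtain r where r: "conjugate M p F Q = ereal r" "r \<ge> 0" using Q ge[of Q] by (cases "conjugate M p F Q") auto
    have le: "b * ((\<integral>x. Q x \<partial>M) - c) \<le> r" for b
      using conjugate_upper[OF Lspace_const[OF p], of b Q F] * r by (simp add: algebra_simps)
    show "(\<integral>x. Q x \<partial>M) = c"
    proof (rule ccontr)
      assume "(\<integral>x. Q x \<partial>M) \<noteq> c"
      \<comment> \<open>At this \<open>b\<close> the left side of \<open>le\<close> equals
        \<open>r + 1\<close>.\<close>
      then show False using le[of "(r + 1) / ((\<integral>x. Q x \<partial>M) - c)"] by simp
    qed
  }
  fix b assume *: "\<forall>Q\<in>conjugate_domain M p q F. (\<integral>x. Q x \<partial>M) = c"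
  show "F (\<lambda>_. b) = ereal (c * b)"
  proof (rule antisym)
    show "ereal (c * b) \<le> F (\<lambda>_. b)" using F(1)[rule_format, OF Lspace_const[OF p, of b]] by (simp add: prob_space)
    show "F (\<lambda>_. b) \<le> ereal (c * b)"
    proof (rule ccontr)
      assume "\<not> F (\<lambda>_. b) \<le> ereal (c * b)"
      then obtain a where a: "ereal (c * b) < ereal a" "ereal a < F (\<lambda>_. b)" using ereal_dense2 not_le by metis
      obtain Q where Q: "Q \<in> conjugate_domain M p q F" "conjugate M p F Q \<le> ereal ((\<integral>x. b * Q x \<partial>M) - a)"
        using fenchel_moreau[OF p pq proper cl conv Lspace_const[OF p] a(2)] by blast
      have "0 \<le> ereal ((\<integral>x. b * Q x \<partial>M) - a)" using ge Q(2) by (rule order_trans)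
      then show False using a * Q(1) by (simp add: mult.commute zero_ereal_def)
    qed
  qed
qed

end

end

theorem proposition20:
  fixes M :: "'a measure" and p :: real and q :: ennreal
    and F :: "('a \<Rightarrow> real) \<Rightarrow> ereal"
  assumes "prob_space M"
    and "1 \<le> p" and "1 / ennreal p + 1 / q = 1"
    and "functional M p F" and "proper_functional M p F"
    and "closed_functional M p F" and "convex_functional M p F"
  defines "Fc \<equiv> conjugate M p F"
    and "Qdom \<equiv> conjugate_domain M p q F"
  shows
    "(subregular_error M p F \<longleftrightarrow>
        (\<forall>Q\<in>Lspace M q. Fc Q \<ge> Fc (\<lambda>_. 0)) \<and> Fc (\<lambda>_. 0) = 0 \<and>
        (\<forall>X\<in>Lspace M p. \<not> as_zero M X \<longrightarrow> (\<exists>Q\<in>Qdom. (\<integral>x. X x * Q x \<partial>M) > 0)))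
   \<and> (subregular_regret M p F \<longleftrightarrow>
        (\<forall>Q\<in>Lspace M q. Fc Q \<ge> Fc (\<lambda>_. 1)) \<and> Fc (\<lambda>_. 1) = 0 \<and>
        (\<forall>X\<in>Lspace M p. \<not> as_zero M X \<longrightarrow>
           (\<exists>Q\<in>Qdom. (\<integral>x. X x * Q x \<partial>M) > (\<integral>x. X x \<partial>M))))
   \<and> (subregular_deviation M p F \<longleftrightarrow>
        (\<forall>Q\<in>Lspace M q. Fc Q \<ge> Fc (\<lambda>_. 0)) \<and> Fc (\<lambda>_. 0) = 0 \<and>
        (\<forall>Q\<in>Qdom. (\<integral>x. Q x \<partial>M) = 0) \<and>
        (\<forall>X\<in>Lspace M p. \<not> as_constant M X \<longrightarrow> (\<exists>Q\<in>Qdom. (\<integral>x. X x * Q x \<partial>M) > 0)))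
   \<and> (subregular_risk M p F \<longleftrightarrow>
        (\<forall>Q\<in>Lspace M q. Fc Q \<ge> Fc (\<lambda>_. 1)) \<and> Fc (\<lambda>_. 1) = 0 \<and>
        (\<forall>Q\<in>Qdom. (\<integral>x. Q x \<partial>M) = 1) \<and>
        (\<forall>X\<in>Lspace M p. \<not> as_constant M X \<longrightarrow>
           (\<exists>Q\<in>Qdom. (\<integral>x. X x * Q x \<partial>M) > (\<integral>x. X x \<partial>M))))"
proof -
  interpret prob_space M by fact
  note ctx = assms(2,3,5,6,7)
  \<comment> \<open>The common core of all four definitions; for deviations and risks the clause at
    0 is their condition on the constant 0.\<close>
  define base where "base c \<longleftrightarrow> (\<forall>X\<in>Lspace M p. ereal (c * (\<integral>x. X x \<partial>M)) \<le> F X) \<and> F (\<lambda>_. 0) = 0" for c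
  have min: "(\<forall>Q\<in>Lspace M q. Fc Q \<ge> Fc (\<lambda>_. c)) \<and> Fc (\<lambda>_. c) = 0 \<longleftrightarrow> base c" for c
    unfolding Fc_def base_def by (rule conjugate_minimum_iff[OF ctx])
  have ray: "(\<forall>X\<in>Lspace M p. P X \<longrightarrow> (\<exists>l>0. ereal (c * (\<integral>x. l * X x \<partial>M)) < F (\<lambda>x. l * X x))) \<longleftrightarrow>
      (\<forall>X\<in>Lspace M p. P X \<longrightarrow> (\<exists>Q\<in>Qdom. c * (\<integral>x. X x \<partial>M) < (\<integral>x. X x * Q x \<partial>M)))"
    if "base c" for c P
    using exceeds_on_ray_iff[OF ctx, of c] that unfolding base_def Qdom_def by blast
  have const: "(\<forall>b::real. F (\<lambda>_. b) = ereal (c * b)) \<longleftrightarrow> (\<forall>Q\<in>Qdom. (\<integral>x. Q x \<partial>M) = c)"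
    if "base c" for c
    using constants_iff[OF ctx, of c] that unfolding base_def Qdom_def by blast
  have "subregular_error M p F \<longleftrightarrow> base 0 \<and>
      (\<forall>X\<in>Lspace M p. \<not> as_zero M X \<longrightarrow> (\<exists>l>0. ereal (0 * (\<integral>x. l * X x \<partial>M)) < F (\<lambda>x. l * X x)))"
    unfolding subregular_error_def base_def using assms(4,6,7) by (auto simp flip: zero_ereal_def)
  moreover have "subregular_regret M p F \<longleftrightarrow> base 1 \<and>
      (\<forall>X\<in>Lspace M p. \<not> as_zero M X \<longrightarrow> (\<exists>l>0. ereal (1 * (\<integral>x. l * X x \<partial>M)) < F (\<lambda>x. l * X x)))"
    unfolding subregular_regret_def base_def using assms(4,6,7) by auto
  moreover have "subregular_deviation M p F \<longleftrightarrow> base 0 \<and> (\<forall>b::real. F (\<lambda>_. b) = ereal (0 * b)) \<and>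
      (\<forall>X\<in>Lspace M p. \<not> as_constant M X \<longrightarrow> (\<exists>l>0. ereal (0 * (\<integral>x. l * X x \<partial>M)) < F (\<lambda>x. l * X x)))"
    unfolding subregular_deviation_def base_def using assms(4,6,7) by (auto simp flip: zero_ereal_def)
  moreover have "subregular_risk M p F \<longleftrightarrow> base 1 \<and> (\<forall>b::real. F (\<lambda>_. b) = ereal (1 * b)) \<and>
      (\<forall>X\<in>Lspace M p. \<not> as_constant M X \<longrightarrow> (\<exists>l>0. ereal (1 * (\<integral>x. l * X x \<partial>M)) < F (\<lambda>x. l * X x)))"
    unfolding subregular_risk_def base_def using assms(4,6,7) by (auto simp: zero_ereal_def)
  \<comment> \<open>\<open>ray\<close> and \<open>const\<close> hold only under
    \<open>base c\<close>, which by \<open>min\<close> stands on both sides of each equivalence; the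
    rest is propositional.\<close>
  ultimately show ?thesis
    using min[of 0] min[of 1] ray[of 0 "\<lambda>X. \<not> as_zero M X"] ray[of 1 "\<lambda>X. \<not> as_zero M X"]
      ray[of 0 "\<lambda>X. \<not> as_constant M X"] ray[of 1 "\<lambda>X. \<not> as_constant M X"] const[of 0] const[of 1]
    unfolding mult_zero_left mult_1 by argo
qed

end
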